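(* Let $K:SO(3)\times SO(3)\to\mathbb{R}$ be of the form $K(R,Q)=g(d(R,Q)^2)$ with $g:[0,\infty)\to\mathbb{R}$ differentiable with locally Lipschitz continuous derivative. Let $\rho_0\in\mathcal{P}(\mathcal{D}_\varepsilon)$ have support that is a compact subset of $\mathcal{D}_\varepsilon$. Then there exist $T>0$ and a unique weak solution $\rho\in \mathrm{C}([0,T);\mathcal{P}(\mathcal{D}_\varepsilon))$ to the aggregation model $\partial_t\rho+\nabla\cdot(\rho v)=0$, $v=-\nabla K*\rho$, starting from $\rho_0$.
   Context: $SO(3)$ is the group of $3\times3$ rotation matrices, with $T_RSO(3)=\{RA: A\in\mathbb{R}^{3\times3},\ A^T=-A\}$ and Riemannian metric $RA_1\cdot RA_2=\frac12\langle A_1,A_2\rangle_F$ ($\langle\cdot,\cdot\rangle_F$ is the Frobenius inner product). $d$ is the geodesic distance, $d(R,Q)=\arccos\big(\frac{\mathrm{tr}(R^TQ)-1}{2}\big)$, and $\nabla$ is the Riemannian gradient on $SO(3)$. Fix $\varepsilon\in(0,\pi/2)$ (arbitrarily small) and let $\mathcal{D}_\varepsilon=\{R\in SO(3): d(I,R)<\frac{\pi}{2}-\varepsilon\}$. $\mathcal{P}(\mathcal{D}_\varepsilon)$ is the set of Borel probability measures on $\mathcal{D}_\varepsilon$; $\mathrm{C}([0,T);\mathcal{P}(\mathcal{D}_\varepsilon))$ is the set of curves $[0,T)\to\mathcal{P}(\mathcal{D}_\varepsilon)$ that are continuous for the narrow topology (convergence against bounded continuous functions). Write $K_Q(R)=K(R,Q)$.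 For a curve $\rho=(\rho_t)$ in $\mathcal{P}(\mathcal{D}_\varepsilon)$ the velocity field is $v[\rho](R,t)=-\int_{\mathcal{D}_\varepsilon}\nabla K_Q(R)\,d\rho_t(Q)$, $R\in\mathcal{D}_\varepsilon$ (gradient in the variable $R$). For $\Sigma\subset\mathcal{D}_\varepsilon$ and a time-dependent tangent vector field $X$ on $\mathcal{D}_\varepsilon$, a flow map generated by $(X,\Sigma)$ on $[0,\tau)$ is a map $\Psi_X:\Sigma\times[0,\tau)\to\mathcal{D}_\varepsilon$ with $\frac{d}{dt}\Psi_X^t(R)=X_t(\Psi_X^t(R))$, $\Psi_X^0(R)=R$. Weak solution: $(\rho_t)_{t\in[0,T)}\subset\mathcal{P}(\mathcal{D}_\varepsilon)$ is a weak solution starting from $\rho_0$ if $v[\rho]$ generates a unique flow map $\Psi_{v[\rho]}$ defined on $\mathrm{supp}(\rho_0)\times[0,T)$ and $\rho_t=\Psi^t_{v[\rho]}\#\rho_0$ (push-forward) for all $t\in[0,T)$. *)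

theory Defs
  imports "HOL-Probability.Probability"
begin

section \<open>The rotation group as an embedded Riemannian manifold\<close>

type_synonym mat3 = "real^3^3"

definition SO3 :: "mat3 set" where
  "SO3 = {R. rotation_matrix R}"

definition tangent_SO3 :: "mat3 \<Rightarrow> mat3 set" where
  "tangent_SO3 R = {R ** A | A. transpose A = - A}"

text \<open>For \<open>V = R ** A\<close> and \<open>W = R ** B\<close> with \<open>R\<close> orthogonal, \<open>transpose R ** V = A\<close> and
  \<open>transpose R ** W = B\<close>; the inner product of \<^typ>\<open>real^3^3\<close> is the Frobenius one.\<close>

definition metric_SO3 :: "mat3 \<Rightarrow> mat3 \<Rightarrow> mat3 \<Rightarrow> real" where
  "metric_SO3 R V W = (1/2) * ((transpose R ** V) \<bullet> (transpose R ** W))"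

definition geo_dist :: "mat3 \<Rightarrow> mat3 \<Rightarrow> real" where
  "geo_dist R Q = arccos ((trace (transpose R ** Q) - 1) / 2)"

text \<open>The filter \<open>at R within SO3\<close> makes this differentiability on the embedded submanifold.
  The derivative \<open>D\<close> on the ambient space is not unique, but its restriction to the tangent
  space at \<open>R\<close>, the differential of \<open>f\<close>, is; the gradient represents it in the metric.
  Values of \<open>f\<close> outside \<^term>\<open>SO3\<close> play no role.\<close>

definition has_riem_grad :: "(mat3 \<Rightarrow> real) \<Rightarrow> mat3 \<Rightarrow> mat3 \<Rightarrow> bool" where
  "has_riem_grad f V R \<longleftrightarrow> V \<in> tangent_SO3 R \<and>
     (\<exists>D. (f has_derivative D) (at R within SO3) \<and>
          (\<forall>W\<in>tangent_SO3 R. D W = metric_SO3 R V W))"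

definition riem_grad :: "(mat3 \<Rightarrow> real) \<Rightarrow> mat3 \<Rightarrow> mat3" where
  "riem_grad f R = (THE V. has_riem_grad f V R)"

definition Deps :: "real \<Rightarrow> mat3 set" where
  "Deps \<epsilon> = {R \<in> SO3. geo_dist (mat 1) R < pi/2 - \<epsilon>}"


section \<open>Probability measures, support, narrow continuity\<close>

text \<open>Equality of the \<open>\<sigma>\<close>-algebras forces \<open>space \<mu> = Deps \<epsilon>\<close>.\<close>

definition ProbD :: "real \<Rightarrow> mat3 measure set" where
  "ProbD \<epsilon> = {\<mu>. prob_space \<mu> \<and> sets \<mu> = sets (restrict_space borel (Deps \<epsilon>))}"

definition msupport :: "'a::topological_space measure \<Rightarrow> 'a set" where
  "msupport \<mu> = {x \<in> space \<mu>. \<forall>U. open U \<and> x \<in> U \<longrightarrow> emeasure \<mu> (U \<inter> space \<mu>) > 0}"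

definition narrow_conv ::
  "real \<Rightarrow> ('i \<Rightarrow> mat3 measure) \<Rightarrow> mat3 measure \<Rightarrow> 'i filter \<Rightarrow> bool" where
  "narrow_conv \<epsilon> \<mu> \<nu> F \<longleftrightarrow>
     (\<forall>f :: mat3 \<Rightarrow> real. continuous_on (Deps \<epsilon>) f \<and> bounded (f ` Deps \<epsilon>) \<longrightarrow>
        ((\<lambda>i. \<integral>Q. f Q \<partial>\<mu> i) \<longlongrightarrow> (\<integral>Q. f Q \<partial>\<nu>)) F)"

text \<open>A curve on \<open>[0,T)\<close> is a function on all reals of which only the values on
  \<open>{0..<T}\<close> are relevant.\<close>

definition narrow_curves :: "real \<Rightarrow> real \<Rightarrow> (real \<Rightarrow> mat3 measure) set" where
  "narrow_curves \<epsilon> T = {\<rho>. \<forall>t\<in>{0..<T}. \<rho> t \<in> ProbD \<epsilon> \<and>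
                             narrow_conv \<epsilon> \<rho> (\<rho> t) (at t within {0..<T})}"


section \<open>Velocity field, flow maps, weak solutions\<close>

definition velocity ::
  "(mat3 \<Rightarrow> mat3 \<Rightarrow> real) \<Rightarrow> (real \<Rightarrow> mat3 measure) \<Rightarrow> real \<Rightarrow> mat3 \<Rightarrow> mat3" where
  "velocity K \<rho> t R = - (\<integral>Q. riem_grad (\<lambda>R'. K R' Q) R \<partial>\<rho> t)"

text \<open>The derivative at \<open>t = 0\<close> is one-sided.\<close>

definition flow_map ::
  "real \<Rightarrow> (real \<Rightarrow> mat3 \<Rightarrow> mat3) \<Rightarrow> mat3 set \<Rightarrow> real \<Rightarrow> (real \<Rightarrow> mat3 \<Rightarrow> mat3) \<Rightarrow> bool" where
  "flow_map \<epsilon> X \<Sigma> \<tau> \<Psi> \<longleftrightarrow>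
     (\<forall>R\<in>\<Sigma>. \<Psi> 0 R = R \<and>
        (\<forall>t\<in>{0..<\<tau>}. \<Psi> t R \<in> Deps \<epsilon> \<and>
           ((\<lambda>s. \<Psi> s R) has_vector_derivative X t (\<Psi> t R)) (at t within {0..<\<tau>})))"

text \<open>The flow map is defined on the support of \<open>\<rho>0\<close> only, which carries all of \<open>\<rho>0\<close>, so the
  push-forward is taken from the restriction of \<open>\<rho>0\<close> to its support. The measurability of
  \<open>\<Psi> t\<close> is required explicitly because \<^const>\<open>distr\<close> is not a push-forward without it.\<close>

definition weak_solution ::
  "real \<Rightarrow> (mat3 \<Rightarrow> mat3 \<Rightarrow> real) \<Rightarrow> mat3 measure \<Rightarrow> real \<Rightarrow> (real \<Rightarrow> mat3 measure) \<Rightarrow> bool" where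
  "weak_solution \<epsilon> K \<rho>0 T \<rho> \<longleftrightarrow>
     (\<forall>t\<in>{0..<T}. \<rho> t \<in> ProbD \<epsilon>) \<and>
     (\<exists>\<Psi>. flow_map \<epsilon> (velocity K \<rho>) (msupport \<rho>0) T \<Psi> \<and>
        (\<forall>\<Phi>. flow_map \<epsilon> (velocity K \<rho>) (msupport \<rho>0) T \<Phi> \<longrightarrow>
           (\<forall>R\<in>msupport \<rho>0. \<forall>t\<in>{0..<T}. \<Phi> t R = \<Psi> t R)) \<and>
        (\<forall>t\<in>{0..<T}.
           \<Psi> t \<in> restrict_space \<rho>0 (msupport \<rho>0) \<rightarrow>\<^sub>M restrict_space borel (Deps \<epsilon>) \<and>
           \<rho> t = distr (restrict_space \<rho>0 (msupport \<rho>0))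
                       (restrict_space borel (Deps \<epsilon>)) (\<Psi> t)))"


definition locally_lipschitz_on :: "'a::metric_space set \<Rightarrow> ('a \<Rightarrow> 'b::metric_space) \<Rightarrow> bool" where
  "locally_lipschitz_on S f \<longleftrightarrow>
     (\<forall>x\<in>S. \<exists>u>0. \<exists>L. L-lipschitz_on (cball x u \<inter> S) f)"

end

theory Submission
  imports Defs
begin

text \<open>Write \<open>N\<close> for the restriction of \<open>\<rho>0\<close> to its support \<open>\<Sigma>\<close>. A weak solution is the
  push-forward of \<open>N\<close> along its own flow, so the whole problem is the single system of
  characteristics \<open>d/dt \<Psi> t x = \<integral>y. F (\<Psi> t x) (\<Psi> t y) \<partial>N\<close> for \<open>x \<in> \<Sigma>\<close>, where \<open>F R Q\<close> is
  minus the gradient at \<open>R\<close> of the interaction with \<open>Q\<close>. If \<open>F\<close> is bounded and Lipschitz,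
  this is solved for a short time by Banach's fixed-point theorem
  (\<open>mean_field_flow_exists\<close>), and the same contraction estimate gives uniqueness
  (\<open>flows_agree\<close>), with an existence time that depends only on \<open>F\<close> and on the distance
  from \<open>\<Sigma>\<close> to the boundary of the geodesic ball.

  The regularity of \<open>F\<close> is where the geometry enters. With \<open>s = R \<bullet> Q\<close> and
  \<open>\<theta> = arccos ((s - 1) / 2)\<close>, the geodesic distance, \<open>F R Q\<close> equals
  \<open>g' (\<theta>\<^sup>2) * (\<theta> / sin \<theta>)\<close> times \<open>R ** (transpose R ** Q - transpose Q ** R)\<close>
  (\<open>riem_grad_interaction\<close>). The functions \<open>\<theta>\<^sup>2\<close> and \<open>\<theta> / sin \<theta>\<close> are Lipschitz in \<open>s\<close> up
  to \<open>s = 3\<close>, that is \<open>R = Q\<close>, but degenerate at \<open>s = -1\<close>, the cut locus. Two rotations in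
  the ball have trace greater than \<open>1\<close>, whereas rotations \<open>R\<close> and \<open>Q\<close> that differ by a
  half-turn satisfy \<open>trace R + trace Q \<le> 2\<close> (\<open>trace_sum_le_of_half_turn\<close>); by compactness
  \<open>s\<close> stays uniformly above \<open>-1\<close>.

  The kernel is extended to a bounded Lipschitz kernel on all matrices, so that the
  fixed-point argument takes place in a vector space (\<open>velocity_kernel_extension\<close>). The
  extension still has the form \<open>R\<close> times a skew matrix near the group, hence
  \<open>\<gamma> ** transpose \<gamma>\<close> is constant along trajectories and they remain in the group
  (\<open>SO3_flow_invariant\<close>).\<close>

section \<open>Mean-field flows of bounded Lipschitz kernels\<close>

lemma vector_derivative_bound:
  fixes f :: "real \<Rightarrow> 'e::real_normed_vector"
  assumes "convex S" and "\<And>t. t \<in> S \<Longrightarrow> (f has_vector_derivative f' t) (at t within S)"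
    and "\<And>t. t \<in> S \<Longrightarrow> norm (f' t) \<le> B" and "x \<in> S" "y \<in> S"
  shows "norm (f x - f y) \<le> B * \<bar>x - y\<bar>"
proof -
  have "onorm (\<lambda>h. h *\<^sub>R f' t) \<le> B" if "t \<in> S" for t
  proof (rule onorm_le)
    show "norm (h *\<^sub>R f' t) \<le> B * norm h" for h
      using mult_left_mono[OF assms(3)[OF that], of "\<bar>h\<bar>"] by (simp add: mult.commute)
  qed
  then show ?thesis
    using differentiable_bound[of S f "\<lambda>t h. h *\<^sub>R f' t" B x y] assms
    by (simp add: has_vector_derivative_def)
qed

lemma continuous_on_integral_dominated:
  fixes H :: "'a::metric_space \<Rightarrow> 'b \<Rightarrow> 'e::{banach,second_countable_topology}"
  assumes "finite_measure \<mu>"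
    and meas: "\<And>x. x \<in> S \<Longrightarrow> H x \<in> borel_measurable \<mu>"
    and cont: "\<And>y. y \<in> space \<mu> \<Longrightarrow> continuous_on S (\<lambda>x. H x y)"
    and bound: "\<And>x y. x \<in> S \<Longrightarrow> y \<in> space \<mu> \<Longrightarrow> norm (H x y) \<le> M"
  shows "continuous_on S (\<lambda>x. \<integral>y. H x y \<partial>\<mu>)"
proof -
  interpret finite_measure \<mu> by fact
  show ?thesis
    unfolding continuous_on_sequentially comp_def
  proof (intro allI ballI impI, elim conjE)
    fix X a assume a: "a \<in> S" "\<forall>n. X n \<in> S" "X \<longlonglongrightarrow> a"
    show "(\<lambda>n. \<integral>y. H (X n) y \<partial>\<mu>) \<longlonglongrightarrow> (\<integral>y. H a y \<partial>\<mu>)"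
    proof (rule integral_dominated_convergence[where w = "\<lambda>_. M"])
      show "AE y in \<mu>. (\<lambda>n. H (X n) y) \<longlonglongrightarrow> H a y"
        using cont a unfolding continuous_on_sequentially comp_def by auto
    qed (use a meas bound in auto)
  qed
qed

lemma (in prob_space) norm_integral_le_const:
  fixes f :: "'a \<Rightarrow> 'e::{banach,second_countable_topology}"
  assumes "integrable M f" "\<And>y. y \<in> space M \<Longrightarrow> norm (f y) \<le> B"
  shows "norm (\<integral>y. f y \<partial>M) \<le> B"
proof -
  have "norm (\<integral>y. f y \<partial>M) \<le> (\<integral>y. norm (f y) \<partial>M)" by (rule integral_norm_bound)
  also have "\<dots> \<le> B" using assms by (intro integral_le_const) auto
  finally show ?thesis .
qed

lemma integral_rescale_unit:
  fixes f :: "real \<Rightarrow> 'e::euclidean_space"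
  assumes "continuous_on UNIV f" "0 \<le> t"
  shows "t *\<^sub>R integral {0..1} (\<lambda>\<sigma>. f (t * \<sigma>)) = integral {0..t} f"
proof (cases "t = 0")
  case False
  have "(f has_integral integral {0..t} f) (cbox 0 t)"
    using assms by (auto intro!: integrable_integral integrable_continuous_real
        continuous_on_subset[OF assms(1)])
  from has_integral_affinity'[OF this, of t 0] False assms(2)
  have "((\<lambda>\<sigma>. f (t * \<sigma>)) has_integral (integral {0..t} f /\<^sub>R t)) {0..1}"
    by simp
  then show ?thesis using False by (simp add: integral_unique)
qed simp

text \<open>The characteristics of all the points move together. The displacement
  \<open>u (t, x) = \<Psi> t x - x\<close> is a bounded continuous function of \<open>(t, x)\<close>, and the integrated
  equation is a fixed-point equation for \<open>u\<close> in the complete space of such functions; on a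
  time interval of length \<open>T\<close> the right-hand side is \<open>2 * L * T\<close>-Lipschitz in \<open>u\<close>, because
  \<open>u\<close> enters both arguments of \<open>F\<close>.\<close>

lemma mean_field_flow_exists:
  fixes F :: "'e::euclidean_space \<Rightarrow> 'e \<Rightarrow> 'e"
  assumes \<mu>: "prob_space \<mu>" "(\<lambda>y. y) \<in> borel_measurable \<mu>"
    and bound: "\<And>x y. norm (F x y) \<le> M"
    and lip: "\<And>x y x' y'. norm (F x y - F x' y') \<le> L * (norm (x - x') + norm (y - y'))"
    and T: "0 \<le> T" "0 \<le> L" "2 * L * T < 1"
  obtains \<Psi> :: "real \<Rightarrow> 'e \<Rightarrow> 'e"
  where "continuous_on UNIV (\<lambda>(t, x). \<Psi> t x)" "\<And>x. \<Psi> 0 x = x"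
    "\<And>t x. t \<in> {0..T} \<Longrightarrow>
      ((\<lambda>s. \<Psi> s x) has_vector_derivative (\<integral>y. F (\<Psi> t x) (\<Psi> t y) \<partial>\<mu>)) (at t within {0..T})"
proof -
  interpret prob_space \<mu> by fact
  have [measurable]: "(\<lambda>y. y) \<in> borel_measurable \<mu>" by fact
  have M0: "0 \<le> M" using order_trans[OF norm_ge_zero bound] .
  have contF: "continuous_on UNIV (\<lambda>(x, y). F x y)"
  proof -
    have "(2 * L)-lipschitz_on UNIV (\<lambda>(x, y). F x y)"
    proof (rule lipschitz_onI)
      fix p q :: "'e \<times> 'e"
      have "norm (F (fst p) (snd p) - F (fst q) (snd q))
          \<le> L * (norm (fst p - fst q) + norm (snd p - snd q))"
        using lip[of "fst p" "snd p" "fst q" "snd q"] by simp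
      also have "\<dots> \<le> L * (norm (p - q) + norm (p - q))"
        using T dist_fst_le[of p q] dist_snd_le[of p q]
        by (intro mult_left_mono add_mono) (auto simp: dist_norm)
      finally show "dist (case p of (x, y) \<Rightarrow> F x y) (case q of (x, y) \<Rightarrow> F x y) \<le> 2 * L * dist p q"
        by (simp add: dist_norm split_beta)
    qed (use T in simp)
    then show ?thesis by (rule lipschitz_on_continuous_on)
  qed
  have contF': "continuous_on S (\<lambda>z. F (f z) (h z))"
    if "continuous_on S f" "continuous_on S h" for S and f h :: "'z::topological_space \<Rightarrow> 'e"
    using continuous_on_compose2[OF contF, of S "\<lambda>z. (f z, h z)"] that
    by (auto intro!: continuous_intros)
  \<comment> \<open>\<open>h u (s, x)\<close> is the averaged field seen at time \<open>s\<close> by the particle that started at \<open>x\<close>.\<close>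
  define h where "h = (\<lambda>(u :: (real \<times> 'e) \<Rightarrow>\<^sub>C 'e) (s, x).
    \<integral>y. F (x + apply_bcontfun u (s, x)) (y + apply_bcontfun u (s, y)) \<partial>\<mu>)"
  have meas [measurable]: "(\<lambda>y. F a (y + apply_bcontfun u (s, y))) \<in> borel_measurable \<mu>" for a s u
  proof -
    have "(\<lambda>y. F a (y + apply_bcontfun u (s, y))) \<in> borel_measurable borel"
      by (intro borel_measurable_continuous_onI contF' continuous_intros
          continuous_on_compose2[OF continuous_on_apply_bcontfun[of UNIV]]) auto
    from measurable_compose[OF _ this, of "\<lambda>y. y"] show ?thesis by simp
  qed
  have int: "integrable \<mu> (\<lambda>y. F a (y + apply_bcontfun u (s, y)))" for a s u
    by (rule integrable_const_bound[where B = M]) (auto simp: bound)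
  have h_bound: "norm (h u p) \<le> M" for u p
  proof -
    obtain s x where p: "p = (s, x)" by force
    show ?thesis
      unfolding h_def p prod.case by (rule norm_integral_le_const) (auto simp: int bound)
  qed
  have h_cont: "continuous_on UNIV (h u)" for u
    unfolding h_def split_beta
    by (rule continuous_on_integral_dominated[where M = M])
      (auto simp: bound finite_measure_axioms intro!: contF' continuous_intros
          continuous_on_compose2[OF continuous_on_apply_bcontfun[of UNIV]])
  have h_cont': "continuous_on S (\<lambda>z. h u (f z))" if "continuous_on S f"
    for u S and f :: "'z::topological_space \<Rightarrow> real \<times> 'e"
    using continuous_on_compose2[OF h_cont that] by auto
  have h_lip: "norm (h u p - h v p) \<le> 2 * L * dist u v" for u v p
  proof -
    obtain s x where p: "p = (s, x)" by force
    have "norm (h u p - h v p)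
        = norm (\<integral>y. F (x + apply_bcontfun u (s, x)) (y + apply_bcontfun u (s, y))
        - F (x + apply_bcontfun v (s, x)) (y + apply_bcontfun v (s, y)) \<partial>\<mu>)"
      unfolding h_def p by (simp add: int)
    also have "\<dots> \<le> 2 * L * dist u v"
    proof (rule norm_integral_le_const)
      fix y
      have "norm (F (x + apply_bcontfun u (s, x)) (y + apply_bcontfun u (s, y))
        - F (x + apply_bcontfun v (s, x)) (y + apply_bcontfun v (s, y)))
        \<le> L * (dist (apply_bcontfun u (s, x)) (apply_bcontfun v (s, x))
            + dist (apply_bcontfun u (s, y)) (apply_bcontfun v (s, y)))"
        using lip[of "x + apply_bcontfun u (s, x)" "y + apply_bcontfun u (s, y)"
            "x + apply_bcontfun v (s, x)" "y + apply_bcontfun v (s, y)"]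
        by (simp add: dist_norm)
      also have "\<dots> \<le> L * (dist u v + dist u v)"
        using T by (intro mult_left_mono add_mono dist_bounded) auto
      finally show "norm (F (x + apply_bcontfun u (s, x)) (y + apply_bcontfun u (s, y))
        - F (x + apply_bcontfun v (s, x)) (y + apply_bcontfun v (s, y))) \<le> 2 * L * dist u v"
        by simp
    qed (auto simp: int)
    finally show ?thesis .
  qed
  \<comment> \<open>Times outside \<open>{0..T}\<close> are clamped, so that the operator acts on functions of all real times.
    Rescaling the time integral to \<open>{0..1}\<close> makes its continuity in the upper limit a case of
    continuity in a parameter.\<close>
  define \<tau> where "\<tau> t = min T (max 0 t)" for t
  have \<tau>: "0 \<le> \<tau> t" "\<tau> t \<le> T" for t using T by (auto simp: \<tau>_def)
  define P0 where "P0 u = (\<lambda>(t, x). \<tau> t *\<^sub>R integral (cbox 0 1) (\<lambda>\<sigma>. h u (\<tau> t * \<sigma>, x)))" for u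
  have intg: "(\<lambda>\<sigma>. h u (c * \<sigma>, x)) integrable_on {0..1}" for u c x
    by (intro integrable_continuous_real h_cont' continuous_intros)
  have P0_cont: "continuous_on UNIV (P0 u)" for u
    unfolding P0_def split_beta
  proof (intro continuous_on_scaleR)
    show "continuous_on UNIV (\<lambda>p. \<tau> (fst p))" unfolding \<tau>_def by (intro continuous_intros)
    show "continuous_on UNIV (\<lambda>p. integral (cbox 0 1) (\<lambda>\<sigma>. h u (\<tau> (fst p) * \<sigma>, snd p)))"
      by (intro integral_continuous_on_param)
        (auto simp: split_beta \<tau>_def intro!: h_cont' continuous_intros)
  qed
  have unit_bound: "norm (integral {0..1::real} f) \<le> B"
    if "f integrable_on {0..1}" "\<And>x. norm (f x) \<le> B" for f :: "real \<Rightarrow> 'e" and B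
    using Henstock_Kurzweil_Integration.integral_norm_bound_integral[OF that(1), of "\<lambda>_. B"] that(2)
    by auto
  have P0_bound: "norm (P0 u p) \<le> T * M" for u and p :: "real \<times> 'e"
    unfolding P0_def split_beta using \<tau> M0 T unit_bound[OF intg h_bound]
    by (auto intro!: mult_mono)
  define P where "P u = Bcontfun (P0 u)" for u
  have P: "apply_bcontfun (P u) = P0 u" for u
    unfolding P_def by (rule Bcontfun_inverse) (rule bcontfun_normI[OF P0_cont P0_bound])
  have contraction: "dist (P u) (P v) \<le> 2 * L * T * dist u v" for u v
  proof (rule dist_bound)
    fix p :: "real \<times> 'e"
    obtain t x where p: "p = (t, x)" by force
    have "norm (P0 u p - P0 v p)
        = \<tau> t * norm (integral {0..1} (\<lambda>\<sigma>. h u (\<tau> t * \<sigma>, x) - h v (\<tau> t * \<sigma>, x)))"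
      unfolding P0_def p using \<tau>[of t]
      by (simp add: scaleR_diff_right[symmetric]
          Henstock_Kurzweil_Integration.integral_diff[OF intg intg])
    also have "\<dots> \<le> T * (2 * L * dist u v)"
      using \<tau>[of t] T by (intro mult_mono unit_bound integrable_diff intg h_lip) auto
    finally show "dist (apply_bcontfun (P u) p) (apply_bcontfun (P v) p) \<le> 2 * L * T * dist u v"
      by (simp add: P dist_norm mult_ac)
  qed
  obtain u where u: "P u = u"
    using banach_fix_type[of "2 * L * T" P] contraction T by auto
  define \<Psi> where "\<Psi> t x = x + apply_bcontfun u (t, x)" for t x
  have eq: "\<Psi> t x = x + integral {0..t} (\<lambda>s. h u (s, x))" if "t \<in> {0..T}" for t x
  proof -
    have "apply_bcontfun u (t, x) = P0 u (t, x)" by (metis P u)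
    also have "\<dots> = integral {0..t} (\<lambda>s. h u (s, x))"
      unfolding P0_def using that
      by (subst integral_rescale_unit[symmetric])
        (auto simp: \<tau>_def intro!: h_cont' continuous_intros)
    finally show ?thesis by (simp add: \<Psi>_def)
  qed
  have [simp]: "(\<lambda>y. F (\<Psi> t x) (\<Psi> t y)) \<in> borel_measurable \<mu>" for t x by (simp add: \<Psi>_def)
  show thesis
  proof (rule that[of \<Psi>])
    show "continuous_on UNIV (\<lambda>(t, x). \<Psi> t x)"
      unfolding \<Psi>_def split_beta
      by (intro continuous_intros
          continuous_on_compose2[OF continuous_on_apply_bcontfun[of UNIV]]) auto
    show "\<Psi> 0 x = x" for x using eq[of 0 x] T by simp
    fix t x assume t: "t \<in> {0..T}"
    have "((\<lambda>s. integral {0..s} (\<lambda>s. h u (s, x))) has_vector_derivative h u (t, x))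
        (at t within {0..T})"
      by (rule integral_has_vector_derivative) (use t in \<open>auto intro!: h_cont' continuous_intros\<close>)
    then have "((\<lambda>s. x + integral {0..s} (\<lambda>s. h u (s, x))) has_vector_derivative h u (t, x))
        (at t within {0..T})"
      by (auto intro!: derivative_eq_intros)
    then have "((\<lambda>s. \<Psi> s x) has_vector_derivative h u (t, x)) (at t within {0..T})"
      by (rule has_vector_derivative_transform[rotated 2]) (use t eq in auto)
    then show "((\<lambda>s. \<Psi> s x) has_vector_derivative (\<integral>y. F (\<Psi> t x) (\<Psi> t y) \<partial>\<mu>)) (at t within {0..T})"
      by (simp add: h_def \<Psi>_def)
  qed
qed

section \<open>Rotation matrices and the geodesic ball\<close>

lemma matrix_mult_add_left:
  fixes A B :: "real^'n^'m" and C :: "real^'k^'n"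
  shows "(A + B) ** C = A ** C + B ** C"
  by (simp add: matrix_matrix_mult_def vec_eq_iff sum.distrib algebra_simps)

lemma matrix_mult_diff_right:
  fixes A :: "real^'n^'m" and B C :: "real^'k^'n"
  shows "A ** (B - C) = A ** B - A ** C"
  by (simp add: matrix_matrix_mult_def vec_eq_iff sum_subtractf algebra_simps)

lemma transpose_diff: "transpose (A - B) = transpose A - transpose (B :: real^'n^'m)"
  by (simp add: transpose_def vec_eq_iff)

lemma transpose_minus: "transpose (- A) = - transpose (A :: real^'n^'m)"
  by (simp add: transpose_def vec_eq_iff)

lemma bounded_bilinear_matrix_mult:
  "bounded_bilinear ((**) :: real^'n^'m \<Rightarrow> real^'k^'n \<Rightarrow> real^'k^'m)"
proof -
  have "bilinear ((**) :: real^'n^'m \<Rightarrow> real^'k^'n \<Rightarrow> real^'k^'m)"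
    unfolding bilinear_def
    by (intro conjI allI linearI)
      (simp_all add: matrix_matrix_mult_def vec_eq_iff sum.distrib sum_distrib_left algebra_simps)
  then show ?thesis by (simp add: bilinear_conv_bounded_bilinear)
qed

lemma bounded_linear_transpose: "bounded_linear (transpose :: real^'n^'m \<Rightarrow> real^'m^'n)"
  unfolding linear_conv_bounded_linear[symmetric]
  by (intro linearI) (simp_all add: transpose_def vec_eq_iff)

lemma trace_mult_transpose: "trace (transpose R ** Q) = R \<bullet> (Q :: real^'n^'n)"
  unfolding trace_def matrix_matrix_mult_def transpose_def inner_vec_def
  by (simp, rule sum.swap)

lemma SO3_D:
  assumes "R \<in> SO3"
  shows "transpose R ** R = mat 1" "R ** transpose R = mat 1" "det R = 1"
  using assms by (auto simp: SO3_def rotation_matrix_def orthogonal_matrix_def)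

lemma SO3_I: "transpose R ** R = mat 1 \<Longrightarrow> det R = 1 \<Longrightarrow> R \<in> SO3"
  by (simp add: SO3_def rotation_matrix_def orthogonal_matrix)

lemma SO3_mult: "R \<in> SO3 \<Longrightarrow> Q \<in> SO3 \<Longrightarrow> R ** Q \<in> SO3"
  by (simp add: SO3_def rotation_matrix_def orthogonal_matrix_mul det_mul)

lemma SO3_transpose: "R \<in> SO3 \<Longrightarrow> transpose R \<in> SO3"
  by (simp add: SO3_def rotation_matrix_def)

lemma SO3_id: "mat 1 \<in> SO3"
  by (simp add: SO3_def rotation_matrix_def orthogonal_matrix_id)

lemma norm_SO3: assumes "R \<in> SO3" shows "norm R = sqrt 3"
  using SO3_D(1)[OF assms] trace_mult_transpose[of R R] by (simp add: norm_eq_sqrt_inner trace_I)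

text \<open>A rotation preserves cross products, so it is its own cofactor matrix. Hence the second
  elementary symmetric function of its eigenvalues, which is the trace of the cofactor
  matrix, equals its trace.\<close>

lemma trace_square_SO3:
  assumes "P \<in> SO3"
  shows "trace (P ** P) = (trace P)\<^sup>2 - 2 * trace P"
proof -
  have c: "cross3 (P *v x) (P *v y) = P *v cross3 x y" for x y
    using assms cross_rotation_matrix by (simp add: SO3_def)
  have minors: "P$1$1 = P$2$2 * P$3$3 - P$3$2 * P$2$3" "P$2$2 = P$3$3 * P$1$1 - P$1$3 * P$3$1"
    "P$3$3 = P$1$1 * P$2$2 - P$2$1 * P$1$2"
    using c[of "axis 2 1" "axis 3 1"] c[of "axis 3 1" "axis 1 1"] c[of "axis 1 1" "axis 2 1"]
    by (simp_all add: cross3_def matrix_vector_mult_def vec_eq_iff forall_3 sum_3 axis_def)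
  have "(trace P)\<^sup>2 - trace (P ** P) = 2 * ((P$2$2 * P$3$3 - P$3$2 * P$2$3)
      + (P$3$3 * P$1$1 - P$1$3 * P$3$1) + (P$1$1 * P$2$2 - P$2$1 * P$1$2))"
    by (simp add: trace_def sum_3 matrix_matrix_mult_def power2_eq_square algebra_simps)
  also have "\<dots> = 2 * trace P"
    unfolding minors[symmetric] by (simp add: trace_def sum_3)
  finally show ?thesis by simp
qed

lemma abs_trace_mult_le: "\<bar>trace (A ** B)\<bar> \<le> norm A * norm (B :: mat3)"
proof -
  have "trace (A ** B) = transpose A \<bullet> B"
    using trace_mult_transpose[of "transpose A" B] by simp
  moreover have "norm (transpose A) = norm A"
    by (simp add: norm_eq_sqrt_inner inner_vec_def transpose_def sum_3)
  ultimately show ?thesis using Cauchy_Schwarz_ineq2[of "transpose A" B] by simp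
qed

lemma trace_SO3_bounds:
  assumes "P \<in> SO3" shows "-1 \<le> trace P" "trace P \<le> 3"
proof -
  have "(trace P)\<^sup>2 - 2 * trace P \<le> 3"
    using abs_trace_mult_le[of P P] norm_SO3[OF assms] trace_square_SO3[OF assms] by simp
  then have "(trace P - 3) * (trace P + 1) \<le> 0"
    by (simp add: algebra_simps power2_eq_square)
  then show "-1 \<le> trace P" "trace P \<le> 3" by (auto simp: mult_le_0_iff)
qed

lemma inner_SO3_bounds:
  assumes "R \<in> SO3" "Q \<in> SO3" shows "-1 \<le> R \<bullet> Q" "R \<bullet> Q \<le> 3"
  using trace_SO3_bounds[OF SO3_mult[OF SO3_transpose[OF assms(1)] assms(2)]]
  by (simp_all add: trace_mult_transpose)

lemma trace_minus_one_symmetric: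
  assumes P: "P \<in> SO3" and tr: "trace P = -1"
  shows "transpose P = P"
proof -
  have "norm (P - transpose P)^2 = 2 * (P \<bullet> P) - 2 * trace (P ** P)"
    unfolding power2_norm_eq_inner
    by (simp add: trace_def sum_3 matrix_matrix_mult_def transpose_def inner_vec_def algebra_simps)
  also have "\<dots> = 0"
    using norm_SO3[OF P] trace_square_SO3[OF P] tr by (simp add: norm_eq_sqrt_inner)
  finally show ?thesis by simp
qed

text \<open>A rotation \<open>P\<close> of trace \<open>-1\<close> is the half-turn about an axis, and \<open>N = (P + I) / 2\<close> is the
  orthogonal projection onto that axis. The left-hand side of the claim is twice the trace
  of \<open>R ** N = (R ** N) ** N\<close>, which Cauchy--Schwarz bounds.\<close>

lemma trace_sum_le_of_half_turn:
  assumes R: "R \<in> SO3" and P: "P \<in> SO3" and tr: "trace P = -1"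
  shows "trace R + trace (R ** P) \<le> 2"
proof -
  define N :: mat3 where "N = (1/2) *\<^sub>R (P + mat 1)"
  have sym: "transpose P = P" by (rule trace_minus_one_symmetric) fact+
  have PP: "P ** P = mat 1" using SO3_D(1)[OF P] sym by simp
  have NN: "N ** N = N"
    unfolding N_def
    by (simp add: matrix_add_ldistrib matrix_mult_add_left PP
        matrix_scalar_ac scalar_matrix_assoc[symmetric] vec_eq_iff field_simps)
  have trN: "trace N = 1"
    using tr by (simp add: N_def trace_def sum_3 mat_def field_simps)
  have "transpose N = N"
    using sym by (simp add: N_def transpose_def vec_eq_iff mat_def)
  with NN trN have "norm N = 1"
    using trace_mult_transpose[of N N] by (simp add: norm_eq_sqrt_inner)
  moreover have "norm (R ** N) = norm N"
  proof -
    have "(R ** N) \<bullet> (R ** N) = N \<bullet> N"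
      using SO3_D(1)[OF R] unfolding trace_mult_transpose[symmetric]
      by (metis matrix_mul_assoc matrix_mul_lid matrix_transpose_mul)
    then show ?thesis by (simp add: norm_eq_sqrt_inner)
  qed
  ultimately have "trace (R ** N ** N) \<le> 1"
    using abs_trace_mult_le[of "R ** N" N] by simp
  then have "trace (R ** N) \<le> 1" by (simp add: NN matrix_mul_assoc[symmetric])
  then show ?thesis
    by (simp add: N_def trace_def sum_3 matrix_matrix_mult_def mat_def algebra_simps)
qed

text \<open>Two rotations whose traces add up to more than \<open>2\<close>, in particular two rotations by less
  than a right angle, do not differ by a half-turn: the geodesic distance stays off its
  cut locus.\<close>

lemma inner_SO3_gt:
  assumes "R \<in> SO3" "Q \<in> SO3" "trace R + trace Q > 2"
  shows "R \<bullet> Q > -1"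
proof (rule ccontr)
  assume "\<not> R \<bullet> Q > -1"
  then have "trace (transpose R ** Q) = -1"
    using inner_SO3_bounds(1)[OF assms(1,2)] by (simp add: trace_mult_transpose)
  moreover have "R ** (transpose R ** Q) = Q"
    using SO3_D[OF assms(1)] by (simp add: matrix_mul_assoc)
  ultimately show False
    using trace_sum_le_of_half_turn[OF assms(1) SO3_mult[OF SO3_transpose[OF assms(1)] assms(2)]]
      assms(3)
    by simp
qed

lemma continuous_on_matrix_mult [continuous_intros]:
  fixes f :: "'a::topological_space \<Rightarrow> real^'n^'m" and h :: "'a \<Rightarrow> real^'k^'n"
  assumes "continuous_on S f" "continuous_on S h"
  shows "continuous_on S (\<lambda>x. f x ** h x)"
  unfolding matrix_matrix_mult_def by (intro continuous_intros assms)

lemma continuous_on_transpose [continuous_intros]: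
  fixes f :: "'a::topological_space \<Rightarrow> real^'n^'m"
  assumes "continuous_on S f"
  shows "continuous_on S (\<lambda>x. transpose (f x))"
  unfolding transpose_def by (intro continuous_intros assms)

lemma continuous_on_det [continuous_intros]:
  fixes f :: "'a::topological_space \<Rightarrow> real^'n^'n"
  assumes "continuous_on S f"
  shows "continuous_on S (\<lambda>x. det (f x))"
  unfolding det_def by (intro continuous_intros assms)

lemma compact_SO3: "compact SO3"
proof -
  have "SO3 = (\<lambda>R. (transpose R ** R, det R)) -` {(mat 1, 1)}"
    by (auto dest: SO3_D SO3_I)
  moreover have "closed ((\<lambda>R :: mat3. (transpose R ** R, det R)) -` {(mat 1, 1)})"
    by (intro closed_vimage continuous_intros)
  moreover have "bounded SO3" by (rule boundedI[of _ "sqrt 3"]) (simp add: norm_SO3)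
  ultimately show ?thesis by (simp add: compact_eq_bounded_closed)
qed

lemma trace_eq_inner: "trace R = mat 1 \<bullet> (R :: real^'n^'n)"
  using trace_mult_transpose[of "mat 1" R] by simp

lemma Deps_eq:
  assumes "0 < \<epsilon>" "\<epsilon> < pi/2"
  shows "Deps \<epsilon> = {R \<in> SO3. trace R > 1 + 2 * sin \<epsilon>}"
proof -
  have "(geo_dist (mat 1) R < pi/2 - \<epsilon>) = (trace R > 1 + 2 * sin \<epsilon>)" if "R \<in> SO3" for R
  proof -
    have b: "-1 \<le> (trace R - 1) / 2" "(trace R - 1) / 2 \<le> 1"
      using trace_SO3_bounds[OF that] by auto
    have "sin \<epsilon> = cos (pi/2 - \<epsilon>)" by (simp add: sin_cos_eq)
    have "arccos (sin \<epsilon>) = pi/2 - \<epsilon>"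
      using assms by (simp add: \<open>sin \<epsilon> = cos (pi/2 - \<epsilon>)\<close> arccos_cos)
    then have "(geo_dist (mat 1) R < pi/2 - \<epsilon>) = (arccos ((trace R - 1) / 2) < arccos (sin \<epsilon>))"
      by (simp add: geo_dist_def)
    also have "\<dots> = (sin \<epsilon> < (trace R - 1) / 2)"
      using b by (intro arccos_less_mono) (auto simp: abs_le_iff)
    finally show ?thesis by auto
  qed
  then show ?thesis by (auto simp: Deps_def)
qed

text \<open>Compactness makes the distance from the cut locus uniform over the ball.\<close>

lemma Deps_inner_lower_bound:
  assumes "0 < \<epsilon>" "\<epsilon> < pi/2"
  obtains \<delta> where "0 < \<delta>" "\<delta> \<le> 1" "\<And>R Q. R \<in> Deps \<epsilon> \<Longrightarrow> Q \<in> Deps \<epsilon> \<Longrightarrow> -1 + \<delta> \<le> R \<bullet> Q"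
proof -
  define C :: "mat3 set" where "C = SO3 \<inter> {R. mat 1 \<bullet> R \<ge> 1 + 2 * sin \<epsilon>}"
  have sin: "sin \<epsilon> > 0" using assms by (intro sin_gt_zero) auto
  have "compact C"
    unfolding C_def by (intro compact_Int_closed compact_SO3 closed_Collect_le continuous_intros)
  then have cp: "compact (C \<times> C)" by (intro compact_Times)
  have ne: "C \<times> C \<noteq> {}"
  proof -
    have "mat 1 \<bullet> (mat 1 :: mat3) = 3" by (simp add: trace_eq_inner[symmetric] trace_I)
    then have "mat 1 \<in> C" using SO3_id by (simp add: C_def)
    then show ?thesis by auto
  qed
  have "continuous_on (C \<times> C) (\<lambda>q. fst q \<bullet> snd q)" by (intro continuous_intros)
  from continuous_attains_inf[OF cp ne this]
  obtain p where p: "p \<in> C \<times> C" "\<And>q. q \<in> C \<times> C \<Longrightarrow> fst p \<bullet> snd p \<le> fst q \<bullet> snd q"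
    by blast
  have "fst p \<bullet> snd p > -1"
    using p(1) sin by (intro inner_SO3_gt) (auto simp: C_def trace_eq_inner)
  show thesis
  proof (rule that[of "min 1 (1 + fst p \<bullet> snd p)"])
    fix R Q assume "R \<in> Deps \<epsilon>" "Q \<in> Deps \<epsilon>"
    then have "(R, Q) \<in> C \<times> C" by (auto simp: C_def Deps_eq[OF assms] trace_eq_inner)
    from p(2)[OF this] show "-1 + min 1 (1 + fst p \<bullet> snd p) \<le> R \<bullet> Q" by simp
  qed (use \<open>fst p \<bullet> snd p > -1\<close> in auto)
qed

section \<open>Regularity of the squared angle and of the gradient coefficient\<close>

text \<open>Bounded Lipschitz functions: unlike the Lipschitz functions alone, they are closed under
  products.\<close>

definition bounded_lipschitz_on ::
  "'a::metric_space set \<Rightarrow> ('a \<Rightarrow> 'b::real_normed_vector) \<Rightarrow> bool" where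
  "bounded_lipschitz_on S f \<longleftrightarrow> bounded (f ` S) \<and> (\<exists>L. L-lipschitz_on S f)"

lemma bounded_lipschitz_onE:
  assumes "bounded_lipschitz_on S f"
  obtains B L where "0 \<le> B" "0 \<le> L" "\<And>x. x \<in> S \<Longrightarrow> norm (f x) \<le> B"
    "\<And>x y. x \<in> S \<Longrightarrow> y \<in> S \<Longrightarrow> norm (f x - f y) \<le> L * dist x y"
proof -
  obtain B where "B > 0" "\<forall>x\<in>S. norm (f x) \<le> B"
    using assms by (auto simp: bounded_lipschitz_on_def bounded_pos)
  moreover obtain L where "L-lipschitz_on S f"
    using assms by (auto simp: bounded_lipschitz_on_def)
  ultimately show thesis
    using that[of B L] by (auto simp: lipschitz_on_def dist_norm)
qed

lemma bounded_lipschitz_onI: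
  assumes "\<And>x. x \<in> S \<Longrightarrow> norm (f x) \<le> B"
    and "\<And>x y. x \<in> S \<Longrightarrow> y \<in> S \<Longrightarrow> norm (f x - f y) \<le> L * dist x y"
  shows "bounded_lipschitz_on S f"
proof -
  have "(max 0 L)-lipschitz_on S f"
  proof (rule lipschitz_onI)
    fix x y assume "x \<in> S" "y \<in> S"
    from assms(2)[OF this] show "dist (f x) (f y) \<le> max 0 L * dist x y"
      using mult_right_mono[of L "max 0 L" "dist x y"] by (auto simp: dist_norm)
  qed simp
  then show ?thesis
    unfolding bounded_lipschitz_on_def bounded_iff using assms(1) by blast
qed

lemma bounded_lipschitz_on_bilinear:
  assumes "bounded_bilinear op" "bounded_lipschitz_on S f" "bounded_lipschitz_on S h"
  shows "bounded_lipschitz_on S (\<lambda>x. op (f x) (h x))"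
proof -
  interpret bounded_bilinear op by fact
  obtain K where K: "K > 0" "\<And>a b. norm (op a b) \<le> norm a * norm b * K"
    using pos_bounded by blast
  obtain Bf Lf where f: "0 \<le> Bf" "0 \<le> Lf" "\<And>x. x \<in> S \<Longrightarrow> norm (f x) \<le> Bf"
    "\<And>x y. x \<in> S \<Longrightarrow> y \<in> S \<Longrightarrow> norm (f x - f y) \<le> Lf * dist x y"
    using bounded_lipschitz_onE[OF assms(2)] by blast
  obtain Bh Lh where h: "0 \<le> Bh" "0 \<le> Lh" "\<And>x. x \<in> S \<Longrightarrow> norm (h x) \<le> Bh"
    "\<And>x y. x \<in> S \<Longrightarrow> y \<in> S \<Longrightarrow> norm (h x - h y) \<le> Lh * dist x y"
    using bounded_lipschitz_onE[OF assms(3)] by blast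
  show ?thesis
  proof (rule bounded_lipschitz_onI)
    fix x assume x: "x \<in> S"
    have "norm (f x) * norm (h x) \<le> Bf * Bh" using f(1) f(3)[OF x] h(3)[OF x]
      by (intro mult_mono) auto
    then show "norm (op (f x) (h x)) \<le> Bf * Bh * K"
      using K(2)[of "f x" "h x"] K(1) by (meson mult_right_mono less_imp_le order_trans)
  next
    fix x y assume x: "x \<in> S" and y: "y \<in> S"
    have "op (f x) (h x) - op (f y) (h y) = op (f x - f y) (h x) + op (f y) (h x - h y)"
      by (simp add: diff_left diff_right)
    then have "norm (op (f x) (h x) - op (f y) (h y))
        \<le> norm (op (f x - f y) (h x)) + norm (op (f y) (h x - h y))"
      by (metis norm_triangle_ineq)
    also have "\<dots> \<le> norm (f x - f y) * norm (h x) * K + norm (f y) * norm (h x - h y) * K"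
      using K by (intro add_mono) auto
    also have "\<dots> \<le> (Lf * dist x y) * Bh * K + Bf * (Lh * dist x y) * K"
      using K(1) f(1,2) h(1,2) f(3)[OF y] h(3)[OF x] f(4)[OF x y] h(4)[OF x y]
      by (intro add_mono mult_mono) auto
    finally show "norm (op (f x) (h x) - op (f y) (h y)) \<le> (Lf * Bh * K + Bf * Lh * K) * dist x y"
      by (simp add: algebra_simps)
  qed
qed

lemma bounded_lipschitz_on_linear:
  assumes "bounded_linear h" "bounded_lipschitz_on S f"
  shows "bounded_lipschitz_on S (\<lambda>x. h (f x))"
proof -
  interpret bounded_linear h by fact
  obtain K where K: "K > 0" "\<And>a. norm (h a) \<le> norm a * K" using pos_bounded by blast
  obtain B L where f: "0 \<le> B" "0 \<le> L" "\<And>x. x \<in> S \<Longrightarrow> norm (f x) \<le> B"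
    "\<And>x y. x \<in> S \<Longrightarrow> y \<in> S \<Longrightarrow> norm (f x - f y) \<le> L * dist x y"
    using bounded_lipschitz_onE[OF assms(2)] by blast
  show ?thesis
  proof (rule bounded_lipschitz_onI)
    show "norm (h (f x)) \<le> B * K" if "x \<in> S" for x
      using K(1) K(2)[of "f x"] f(3)[OF that] by (meson mult_right_mono less_imp_le order_trans)
    show "norm (h (f x) - h (f y)) \<le> L * K * dist x y" if "x \<in> S" "y \<in> S" for x y
    proof -
      have "norm (h (f x) - h (f y)) \<le> norm (f x - f y) * K"
        using K(2)[of "f x - f y"] by (simp add: diff)
      also have "\<dots> \<le> L * dist x y * K" using f(4)[OF that] K(1) by (intro mult_right_mono) auto
      finally show ?thesis by (simp add: mult_ac)
    qed
  qed
qed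

lemma bounded_lipschitz_on_diff:
  assumes "bounded_lipschitz_on S f" "bounded_lipschitz_on S h"
  shows "bounded_lipschitz_on S (\<lambda>x. f x - h x)"
  using assms unfolding bounded_lipschitz_on_def
  by (auto intro: lipschitz_on_diff bounded_minus_comp)

lemma bounded_lipschitz_on_compose:
  assumes "bounded_lipschitz_on T h" "L-lipschitz_on S f" "f ` S \<subseteq> T"
  shows "bounded_lipschitz_on S (\<lambda>x. h (f x))"
proof -
  obtain M where "M-lipschitz_on T h" using assms(1) by (auto simp: bounded_lipschitz_on_def)
  then have "(M * L)-lipschitz_on S (\<lambda>x. h (f x))"
    using lipschitz_on_compose2[OF assms(2), of M h] assms(3) lipschitz_on_subset by blast
  moreover have "bounded ((\<lambda>x. h (f x)) ` S)"
    using assms(1,3) bounded_subset[of "h ` T" "(\<lambda>x. h (f x)) ` S"]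
    by (auto simp: bounded_lipschitz_on_def)
  ultimately show ?thesis by (auto simp: bounded_lipschitz_on_def)
qed

lemma bounded_lipschitz_on_inverse:
  fixes f :: "'a::metric_space \<Rightarrow> real"
  assumes "0 < m" "\<And>x. x \<in> S \<Longrightarrow> m \<le> f x" "L-lipschitz_on S f"
  shows "bounded_lipschitz_on S (\<lambda>x. inverse (f x))"
proof (rule bounded_lipschitz_onI)
  show "norm (inverse (f x)) \<le> inverse m" if "x \<in> S" for x
    using assms(1) assms(2)[OF that] by (simp add: le_imp_inverse_le)
  fix x y assume x: "x \<in> S" and y: "y \<in> S"
  have pos: "f x > 0" "f y > 0" using assms(1) assms(2)[OF x] assms(2)[OF y] by auto
  have "norm (inverse (f x) - inverse (f y)) = \<bar>f x - f y\<bar> * (inverse (f x) * inverse (f y))"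
    using pos by (simp add: inverse_diff_inverse abs_mult abs_minus_commute mult_ac)
  also have "\<dots> \<le> (L * dist x y) * (inverse m * inverse m)"
    using pos assms(1) assms(2)[OF x] assms(2)[OF y] lipschitz_onD[OF assms(3) x y]
      lipschitz_on_nonneg[OF assms(3)]
    by (intro mult_mono le_imp_inverse_le) (auto simp: dist_norm)
  finally show "norm (inverse (f x) - inverse (f y)) \<le> L * inverse m * inverse m * dist x y"
    by (simp add: mult_ac)
qed

lemma abs_sin_minus_x_cos_le:
  fixes x :: real
  assumes "0 \<le> x" shows "\<bar>sin x - x * cos x\<bar> \<le> x ^ 3"
proof -
  have *: "\<bar>y * sin y\<bar> \<le> y\<^sup>2" if "0 \<le> y" for y :: real
    using that abs_sin_x_le_abs_x[of y] by (simp add: abs_mult power2_eq_square mult_left_mono)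
  have "0 ^ 3 + (sin 0 - 0 * cos 0) \<le> x ^ 3 + (sin x - x * cos x)"
  proof (rule DERIV_nonneg_imp_nondecreasing[OF assms])
    fix y :: real assume y: "0 \<le> y" "y \<le> x"
    have "((\<lambda>y. y ^ 3 + (sin y - y * cos y)) has_real_derivative 3 * y\<^sup>2 + y * sin y) (at y)"
      by (auto intro!: derivative_eq_intros simp: power2_eq_square)
    moreover have "3 * y\<^sup>2 + y * sin y \<ge> 0"
      using *[OF y(1)] zero_le_power2[of y] by (simp only: abs_le_iff) linarith
    ultimately show "\<exists>z. ((\<lambda>y. y ^ 3 + (sin y - y * cos y)) has_real_derivative z) (at y) \<and> 0 \<le> z"
      by blast
  qed
  moreover have "0 ^ 3 - (sin 0 - 0 * cos 0) \<le> x ^ 3 - (sin x - x * cos x)"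
  proof (rule DERIV_nonneg_imp_nondecreasing[OF assms])
    fix y :: real assume y: "0 \<le> y" "y \<le> x"
    have "((\<lambda>y. y ^ 3 - (sin y - y * cos y)) has_real_derivative 3 * y\<^sup>2 - y * sin y) (at y)"
      by (auto intro!: derivative_eq_intros simp: power2_eq_square)
    moreover have "3 * y\<^sup>2 - y * sin y \<ge> 0"
      using *[OF y(1)] zero_le_power2[of y] by (simp only: abs_le_iff) linarith
    ultimately show "\<exists>z. ((\<lambda>y. y ^ 3 - (sin y - y * cos y)) has_real_derivative z) (at y) \<and> 0 \<le> z"
      by blast
  qed
  ultimately show ?thesis by simp
qed

text \<open>The function \<open>sinc\<close> is a smooth function of the square of its argument. The Lipschitz
  estimate says that \<open>x\<^sup>2 + sinc x\<close> and \<open>x\<^sup>2 - sinc x\<close> are both nondecreasing for \<open>x \<ge> 0\<close>.\<close>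

lemma sinc_square_lipschitz:
  assumes "0 \<le> a" "0 \<le> b"
  shows "\<bar>sinc a - sinc b\<bar> \<le> \<bar>a\<^sup>2 - b\<^sup>2\<bar>"
proof -
  have main: "\<bar>sinc a - sinc b\<bar> \<le> b\<^sup>2 - a\<^sup>2" if "0 \<le> a" "a \<le> b" for a b
  proof -
    have mono: "a\<^sup>2 + c * sinc a \<le> b\<^sup>2 + c * sinc b" if c: "\<bar>c\<bar> = 1" for c :: real
    proof (rule DERIV_nonneg_imp_increasing_open[OF \<open>a \<le> b\<close>])
      fix x assume "a < x" "x < b"
      with \<open>0 \<le> a\<close> have x: "x > 0" by simp
      have "((\<lambda>x. sin x / x) has_real_derivative (x * cos x - sin x) / x\<^sup>2) (at x)"
        using x by (auto intro!: derivative_eq_intros simp: power2_eq_square mult_ac)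
      then have "(sinc has_real_derivative (x * cos x - sin x) / x\<^sup>2) (at x)"
        by (rule has_field_derivative_transform_within_open[where S = "{0<..}"]) (use x in auto)
      then have d: "((\<lambda>x. x\<^sup>2 + c * sinc x)
          has_real_derivative 2 * x + c * ((x * cos x - sin x) / x\<^sup>2)) (at x)"
        by (auto intro!: derivative_eq_intros)
      have "\<bar>c * ((x * cos x - sin x) / x\<^sup>2)\<bar> = \<bar>sin x - x * cos x\<bar> / x\<^sup>2"
        using c by (simp add: abs_mult abs_minus_commute)
      also have "\<dots> \<le> x ^ 3 / x\<^sup>2"
        using abs_sin_minus_x_cos_le[of x] x by (intro divide_right_mono) auto
      also have "\<dots> = x" using x by (simp add: power2_eq_square power3_eq_cube)
      finally have "2 * x + c * ((x * cos x - sin x) / x\<^sup>2) \<ge> 0" using x by linarith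
      with d show "\<exists>y. ((\<lambda>x. x\<^sup>2 + c * sinc x) has_real_derivative y) (at x) \<and> 0 \<le> y" by blast
    qed (intro continuous_intros)
    show ?thesis using mono[of 1] mono[of "-1"] by (simp add: abs_le_iff algebra_simps)
  qed
  show ?thesis
  proof (cases "a \<le> b")
    case True
    have "\<bar>a\<^sup>2 - b\<^sup>2\<bar> = b\<^sup>2 - a\<^sup>2" using power_mono[OF True assms(1), of 2] by simp
    then show ?thesis using main[OF assms(1) True] by (simp only:)
  next
    case False
    then have "b \<le> a" by simp
    have "\<bar>a\<^sup>2 - b\<^sup>2\<bar> = a\<^sup>2 - b\<^sup>2" using power_mono[OF \<open>b \<le> a\<close> assms(2), of 2] by simp
    then show ?thesis using main[OF assms(2) \<open>b \<le> a\<close>] by (simp only: abs_minus_commute)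
  qed
qed

text \<open>The angle of the relative rotation of \<open>R\<close> and \<open>Q\<close>, as a function of
  \<open>s = R \<bullet> Q = trace (transpose R ** Q)\<close>, which ranges over \<open>{-1..3}\<close>. It is not
  differentiable at \<open>s = 3\<close>, where \<open>R = Q\<close>, but its square is.\<close>

definition angle :: "real \<Rightarrow> real" where
  "angle s = arccos ((s - 1) / 2)"

lemma angle_bounds:
  assumes "-1 < s" "s \<le> 3" shows "0 \<le> angle s" "angle s < pi"
proof -
  show "0 \<le> angle s" unfolding angle_def using assms by (intro arccos_lbound) auto
  have "arccos ((s - 1) / 2) < arccos (- 1)" using assms by (intro arccos_less_arccos) auto
  then show "angle s < pi" by (simp add: angle_def)
qed

lemma continuous_on_angle: "continuous_on {-1..3} angle"
  unfolding angle_def by (intro continuous_intros) auto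

lemma sinc_angle_pos:
  assumes "-1 < s" "s \<le> 3" shows "sinc (angle s) > 0"
  using angle_bounds[OF assms] by (auto intro!: divide_pos_pos sin_gt_zero)

lemma angle_square_deriv:
  assumes s: "-1 < s" "s \<le> 3"
  shows "((\<lambda>s. (angle s)\<^sup>2) has_real_derivative (- inverse (sinc (angle s)))) (at s within {-1..3})"
proof (cases "s = 3")
  case False
  define c where "c = (s - 1) / 2"
  have c: "-1 < c" "c < 1" using s False by (auto simp: c_def)
  have c2: "c\<^sup>2 < 1" using c by (simp add: abs_square_less_1 abs_less_iff)
  have ne: "arccos c \<noteq> 0" using c by (simp add: arccos_eq_0_iff)
  have sq: "sin (arccos c) = sqrt (1 - c\<^sup>2)" using c by (intro sin_arccos) auto
  have "(arccos has_real_derivative inverse (- sqrt (1 - c\<^sup>2))) (at ((s - 1) / 2))"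
    using DERIV_arccos[OF c] by (simp add: c_def)
  then have d: "(angle has_real_derivative inverse (- sqrt (1 - c\<^sup>2)) * (1/2)) (at s)"
    unfolding angle_def[abs_def] by (rule DERIV_chain2) (auto intro!: derivative_eq_intros)
  then have "((\<lambda>s. (angle s)\<^sup>2)
      has_real_derivative 2 * angle s * (inverse (- sqrt (1 - c\<^sup>2)) * (1/2))) (at s)"
    using d by (auto intro!: derivative_eq_intros)
  also have "2 * angle s * (inverse (- sqrt (1 - c\<^sup>2)) * (1/2)) = - inverse (sinc (angle s))"
    using ne c2 by (simp add: angle_def c_def[symmetric] sq divide_simps)
  finally show ?thesis by (rule has_field_derivative_at_within)
next
  case True
  have "((\<lambda>y. - inverse ((sinc (angle y / 2))\<^sup>2)) \<longlongrightarrow> - inverse ((sinc (angle 3 / 2))\<^sup>2))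
      (at 3 within {-1..3})"
  proof -
    have "((\<lambda>y. angle y) \<longlongrightarrow> angle 3) (at 3 within {-1..3})"
      using continuous_on_angle by (auto simp: continuous_on_def)
    then have "((\<lambda>y. angle y / 2) \<longlongrightarrow> angle 3 / 2) (at 3 within {-1..3})"
      by (intro tendsto_divide tendsto_const) auto
    from isCont_tendsto_compose[OF isCont_sinc this] show ?thesis
      by (intro tendsto_intros) (auto simp: angle_def)
  qed
  then have "((\<lambda>y. ((angle y)\<^sup>2 - (angle 3)\<^sup>2) / (y - 3)) \<longlongrightarrow> - inverse ((sinc (angle 3 / 2))\<^sup>2))
      (at 3 within {-1..3})"
  proof (rule Lim_transform_within[OF _ zero_less_one])
    fix y :: real assume y: "y \<in> {-1..3}" "0 < dist y 3"
    then have y': "y < 3" by auto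
    have ne: "angle y \<noteq> 0" using y' y by (simp add: angle_def arccos_eq_0_iff)
    \<comment> \<open>The half-angle formula \<open>1 - cos \<theta> = 2 * (sin (\<theta> / 2))\<^sup>2\<close> turns the difference quotient into
      the reciprocal of a square of \<open>sinc\<close>.\<close>
    have "cos (angle y) = (y - 1) / 2" using y by (simp add: angle_def)
    then have "y - 3 = - 4 * (sin (angle y / 2))\<^sup>2"
      using cos_double_sin[of "angle y / 2"] by simp
    then show "- inverse ((sinc (angle y / 2))\<^sup>2) = ((angle y)\<^sup>2 - (angle 3)\<^sup>2) / (y - 3)"
      using ne by (simp add: angle_def[of 3] power_divide divide_simps)
  qed
  then show ?thesis using True by (simp add: has_field_derivative_iff angle_def[of 3])
qed

lemma angle_regularity:
  assumes "0 < \<delta>"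
  obtains m C where "0 < m" "\<And>s. s \<in> {-1+\<delta>..3} \<Longrightarrow> m \<le> sinc (angle s)"
    "C-lipschitz_on {-1+\<delta>..3} (\<lambda>s. (angle s)\<^sup>2)"
proof -
  let ?J = "{-1+\<delta>..3}"
  have "\<exists>m>0. \<forall>s\<in>?J. m \<le> sinc (angle s)"
  proof (cases "?J = {}")
    case False
    have "continuous_on ?J (\<lambda>s. sinc (angle s))"
      by (intro continuous_intros continuous_on_subset[OF continuous_on_angle]) (use assms in auto)
    from continuous_attains_inf[OF _ False this] obtain s where
      "s \<in> ?J" "\<forall>x\<in>?J. sinc (angle s) \<le> sinc (angle x)" by (auto simp del: atLeastAtMost_iff)
    moreover have "sinc (angle s) > 0" using \<open>s \<in> ?J\<close> assms by (intro sinc_angle_pos) auto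
    ultimately show ?thesis by blast
  qed (auto intro: exI[of _ 1])
  then obtain m where m: "m > 0" "\<And>s. s \<in> ?J \<Longrightarrow> m \<le> sinc (angle s)" by blast
  have "(inverse m)-lipschitz_on ?J (\<lambda>s. (angle s)\<^sup>2)"
  proof (rule lipschitz_onI)
    fix x y assume xy: "x \<in> ?J" "y \<in> ?J"
    have "norm ((angle x)\<^sup>2 - (angle y)\<^sup>2) \<le> inverse m * \<bar>x - y\<bar>"
    proof (rule vector_derivative_bound[of ?J])
      fix t assume t: "t \<in> ?J"
      have "((\<lambda>s. (angle s)\<^sup>2) has_real_derivative (- inverse (sinc (angle t)))) (at t within ?J)"
        using assms t by (intro has_field_derivative_subset[OF angle_square_deriv]) auto
      then show "((\<lambda>s. (angle s)\<^sup>2) has_vector_derivative (- inverse (sinc (angle t))))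
          (at t within ?J)"
        by (simp only: has_real_derivative_iff_has_vector_derivative)
      show "norm (- inverse (sinc (angle t))) \<le> inverse m"
        using m(1) m(2)[OF t] le_imp_inverse_le[OF m(2)[OF t] m(1)]
        by (simp only: norm_minus_cancel real_norm_def) auto
    qed (use xy in auto)
    then show "dist ((angle x)\<^sup>2) ((angle y)\<^sup>2) \<le> inverse m * dist x y" by (simp add: dist_norm)
  qed (use m in auto)
  with m that show thesis by blast
qed

lemma locally_lipschitz_on_compact:
  assumes "locally_lipschitz_on S f" "compact K" "K \<subseteq> S"
  obtains L where "L-lipschitz_on K f"
proof -
  \<comment> \<open>The notion \<^const>\<open>local_lipschitz\<close> concerns families with a time parameter; a one-point time set
    serves.\<close>
  have "local_lipschitz {0::real} K (\<lambda>_. f)"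
  proof (rule local_lipschitzI)
    fix t :: real and x assume "x \<in> K"
    then obtain u L where "u > 0" "L-lipschitz_on (cball x u \<inter> S) f"
      using assms unfolding locally_lipschitz_on_def by blast
    moreover from this(2) have "L-lipschitz_on (cball x u \<inter> K) f"
      by (rule lipschitz_on_subset) (use assms(3) in auto)
    ultimately show "\<exists>u>0. \<exists>L. \<forall>t\<in>cball t u \<inter> {0}. L-lipschitz_on (cball x u \<inter> K) f" by blast
  qed
  from local_lipschitz_compact_implies_lipschitz[OF this assms(2)]
  obtain L where "\<And>t. t \<in> {0::real} \<Longrightarrow> L-lipschitz_on K f" by auto
  then show thesis using that by auto
qed

text \<open>For \<open>s = R \<bullet> Q\<close>, the derivative of \<open>g ((angle s)\<^sup>2)\<close> with respect to \<open>s\<close> is minus this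
  coefficient, the product of \<open>g' (\<theta>\<^sup>2)\<close> and \<open>\<theta> / sin \<theta>\<close> for the angle \<open>\<theta>\<close> between \<open>R\<close> and
  \<open>Q\<close>, the latter read as \<open>1\<close> at \<open>\<theta> = 0\<close>.\<close>

definition grad_coeff :: "(real \<Rightarrow> real) \<Rightarrow> real \<Rightarrow> real" where
  "grad_coeff g' s = g' ((angle s)\<^sup>2) * inverse (sinc (angle s))"

lemma grad_coeff_bounded_lipschitz:
  assumes "locally_lipschitz_on {0..} g'" "0 < \<delta>"
  shows "bounded_lipschitz_on {-1+\<delta>..3} (grad_coeff g')"
proof -
  let ?J = "{-1+\<delta>..3}"
  obtain m C where m: "0 < m" "\<And>s. s \<in> ?J \<Longrightarrow> m \<le> sinc (angle s)"
    and C: "C-lipschitz_on ?J (\<lambda>s. (angle s)\<^sup>2)"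
    using angle_regularity[OF assms(2)] by blast
  have ang: "0 \<le> angle s" "angle s \<le> pi" if "s \<in> ?J" for s
    using angle_bounds[of s] that assms(2) by auto
  obtain L where L: "L-lipschitz_on {0..pi\<^sup>2} g'"
    using locally_lipschitz_on_compact[OF assms(1), of "{0..pi\<^sup>2}"] by auto
  have "bounded_lipschitz_on {0..pi\<^sup>2} g'"
    unfolding bounded_lipschitz_on_def
    using L compact_imp_bounded[OF compact_continuous_image[OF lipschitz_on_continuous_on[OF L]]]
    by auto
  then have 1: "bounded_lipschitz_on ?J (\<lambda>s. g' ((angle s)\<^sup>2))"
    by (rule bounded_lipschitz_on_compose[OF _ C]) (use ang in \<open>auto intro!: power_mono\<close>)
  have "C-lipschitz_on ?J (\<lambda>s. sinc (angle s))"
  proof (rule lipschitz_onI)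
    fix x y assume xy: "x \<in> ?J" "y \<in> ?J"
    have "dist (sinc (angle x)) (sinc (angle y)) \<le> dist ((angle x)\<^sup>2) ((angle y)\<^sup>2)"
      using sinc_square_lipschitz[OF ang(1) ang(1)] xy by (simp only: dist_real_def)
    also have "\<dots> \<le> C * dist x y" by (rule lipschitz_onD[OF C xy])
    finally show "dist (sinc (angle x)) (sinc (angle y)) \<le> C * dist x y" .
  qed (rule lipschitz_on_nonneg[OF C])
  from bounded_lipschitz_on_inverse[OF m this]
  show ?thesis
    unfolding grad_coeff_def by (intro bounded_lipschitz_on_bilinear[OF bounded_bilinear_mult] 1)
qed

section \<open>The Riemannian gradient of the interaction\<close>

lemma det_constant_on_connected:
  fixes \<gamma> :: "'a::topological_space \<Rightarrow> real^'n^'n"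
  assumes "connected S" "continuous_on S \<gamma>" "\<And>t. t \<in> S \<Longrightarrow> orthogonal_matrix (\<gamma> t)"
    and "t0 \<in> S" "det (\<gamma> t0) = 1" "t \<in> S"
  shows "det (\<gamma> t) = 1"
proof (rule ccontr)
  assume "det (\<gamma> t) \<noteq> 1"
  then have "det (\<gamma> t) = -1" using det_orthogonal_matrix[OF assms(3)[OF \<open>t \<in> S\<close>]] by auto
  moreover have "connected ((\<lambda>t. det (\<gamma> t)) ` S)"
    by (intro connected_continuous_image continuous_intros assms)
  ultimately have "{-1..1} \<subseteq> (\<lambda>t. det (\<gamma> t)) ` S"
    using assms(4-6) by (intro connected_contains_Icc) (force intro: image_eqI)+
  then have "0 \<in> (\<lambda>t. det (\<gamma> t)) ` S" by (rule subsetD) auto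
  then show False using det_orthogonal_matrix[OF assms(3)] by force
qed

text \<open>Every tangent vector is the velocity of a curve. The curve is the Cayley transform of
  \<open>(t / 2) *\<^sub>R B\<close>, applied to \<open>R\<close>; since \<open>B ** B ** B = - n *\<^sub>R B\<close>, it is an explicit
  combination of the identity, \<open>B\<close> and \<open>B ** B\<close>.\<close>

lemma SO3_curve:
  assumes R: "R \<in> SO3" and B: "transpose B = - B"
  obtains \<gamma> where "\<And>t. \<gamma> t \<in> SO3" "\<gamma> 0 = R" "(\<gamma> has_vector_derivative R ** B) (at (0::real))"
proof -
  define n where "n = (B$1$2)\<^sup>2 + (B$1$3)\<^sup>2 + (B$2$3)\<^sup>2"
  define a where "a t = 2 / (1 + n * (t/2)\<^sup>2)" for t :: real
  define p where "p t = a t * (t/2)" for t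
  define q where "q t = a t * (t/2)\<^sup>2" for t
  define C where "C t = mat 1 + p t *\<^sub>R B + q t *\<^sub>R (B ** B)" for t
  have n0: "n \<ge> 0" by (simp add: n_def)
  have pos: "1 + n * (t/2)\<^sup>2 > 0" for t using n0 by (simp add: add_pos_nonneg)
  have pq: "2 * q t = (p t)\<^sup>2 + n * (q t)\<^sup>2" for t
  proof -
    have "a t * (1 + n * (t/2)\<^sup>2) = 2"
      using nonzero_eq_divide_eq[of "1 + n * (t/2)\<^sup>2" "a t" 2] pos[of t] a_def[of t] by linarith
    then have "a t * (t/2)\<^sup>2 * (a t * (1 + n * (t/2)\<^sup>2)) = 2 * q t" by (simp add: q_def)
    then show ?thesis by (simp add: p_def q_def power_mult_distrib power2_eq_square algebra_simps)
  qed
  have skew: "B$j$i = - B$i$j" for i j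
    using arg_cong[OF B, of "\<lambda>M. M$i$j"] by (simp add: transpose_def)
  have diag: "B$i$i = 0" for i using skew[of i i] by simp
  have off: "B$2$1 = - B$1$2" "B$3$1 = - B$1$3" "B$3$2 = - B$2$3"
    by (rule skew)+
  have orth: "orthogonal_matrix (C t)" for t
  proof -
    have "transpose (C t) ** C t = mat 1 + (2 * q t - (p t)\<^sup>2 - n * (q t)\<^sup>2) *\<^sub>R (B ** B)"
      unfolding C_def n_def
      by (simp add: vec_eq_iff forall_3 transpose_def matrix_matrix_mult_def sum_3 mat_def diag off
          power2_eq_square algebra_simps)
    then show ?thesis by (simp add: orthogonal_matrix pq)
  qed
  have a_cont: "continuous_on UNIV a"
    unfolding a_def using pos by (intro continuous_intros) (auto simp: less_imp_neq[symmetric])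
  have C0: "C 0 = mat 1" by (simp add: C_def p_def q_def)
  have C: "C t \<in> SO3" for t
  proof -
    have "continuous_on UNIV C"
      unfolding C_def p_def q_def by (intro continuous_intros a_cont) auto
    from det_constant_on_connected[OF connected_UNIV this, of 0 t]
    have "det (C t) = 1" by (simp add: C0 orth)
    then show ?thesis using orth by (simp add: SO3_def rotation_matrix_def)
  qed
  have "(a has_real_derivative 0) (at 0)"
    unfolding a_def by (auto intro!: derivative_eq_intros)
  then have "(p has_real_derivative 1) (at 0)" "(q has_real_derivative 0) (at 0)"
    unfolding p_def q_def by (auto intro!: derivative_eq_intros simp: a_def)
  then have "(C has_vector_derivative B) (at 0)"
    unfolding C_def by (auto intro!: derivative_eq_intros)
  then have "((\<lambda>t. R ** C t) has_vector_derivative R ** B) (at 0)"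
    by (rule bounded_linear.has_vector_derivative[OF
          bounded_bilinear.bounded_linear_right[OF bounded_bilinear_matrix_mult]])
  then show thesis
    by (rule that[of "\<lambda>t. R ** C t", rotated 2]) (simp_all add: C0 SO3_mult[OF R C])
qed

lemma tangent_SO3_diff:
  assumes "V \<in> tangent_SO3 R" "W \<in> tangent_SO3 R" shows "V - W \<in> tangent_SO3 R"
proof -
  obtain A B where "V = R ** A" "transpose A = - A" "W = R ** B" "transpose B = - B"
    using assms by (auto simp: tangent_SO3_def)
  then have "V - W = R ** (A - B)" "transpose (A - B) = - (A - B)"
    by (simp_all add: matrix_mult_diff_right transpose_diff)
  then show ?thesis by (auto simp: tangent_SO3_def)
qed

text \<open>A derivative within \<^const>\<open>SO3\<close> is not unique on the ambient space; on tangent vectors it is,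
  because there it is the derivative along a curve.\<close>

lemma SO3_differential_unique:
  assumes R: "R \<in> SO3" and D: "(f has_derivative D) (at R within SO3)"
    and E: "(f has_derivative E) (at R within SO3)" and W: "W \<in> tangent_SO3 R"
  shows "D W = E W"
proof -
  obtain B where B: "W = R ** B" "transpose B = - B" using W by (auto simp: tangent_SO3_def)
  obtain \<gamma> where \<gamma>: "\<And>t. \<gamma> t \<in> SO3" "\<gamma> 0 = R" "(\<gamma> has_vector_derivative R ** B) (at (0::real))"
    using SO3_curve[OF R B(2)] by blast
  have "((f \<circ> \<gamma>) has_vector_derivative G (R ** B)) (at 0)"
    if "(f has_derivative G) (at R within SO3)" for G
  proof (rule vector_derivative_diff_chain_within[OF \<gamma>(3)])
    show "(f has_derivative G) (at (\<gamma> 0) within range \<gamma>)"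
      unfolding \<gamma>(2) by (rule has_derivative_subset[OF that]) (use \<gamma>(1) in auto)
  qed
  from vector_derivative_unique_at[OF this[OF D] this[OF E]] show ?thesis by (simp add: B)
qed

lemma riem_grad_eqI:
  assumes R: "R \<in> SO3" and V: "has_riem_grad f V R"
  shows "riem_grad f R = V"
  unfolding riem_grad_def
proof (rule the_equality)
  show "has_riem_grad f V R" by fact
  fix V' assume V': "has_riem_grad f V' R"
  obtain D D' where D: "(f has_derivative D) (at R within SO3)"
      "\<forall>W\<in>tangent_SO3 R. D W = metric_SO3 R V W"
    and D': "(f has_derivative D') (at R within SO3)" "\<forall>W\<in>tangent_SO3 R. D' W = metric_SO3 R V' W"
    and T: "V \<in> tangent_SO3 R" "V' \<in> tangent_SO3 R"
    using V V' by (auto simp: has_riem_grad_def)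
  define W where "W = V - V'"
  have W: "W \<in> tangent_SO3 R" using tangent_SO3_diff[OF T] by (simp add: W_def)
  have "metric_SO3 R V W = metric_SO3 R V' W"
    using SO3_differential_unique[OF R D(1) D'(1) W] D(2) D'(2) W by auto
  then have "(transpose R ** W) \<bullet> (transpose R ** W) = 0"
    by (simp add: metric_SO3_def W_def matrix_mult_diff_right inner_diff_left)
  then have "R ** (transpose R ** W) = R ** 0" by simp
  then have "W = 0"
    using SO3_D(2)[OF R] by (simp add: matrix_mul_assoc
        bounded_bilinear.zero_right[OF bounded_bilinear_matrix_mult])
  then show "V' = V" by (simp add: W_def)
qed

text \<open>Since \<open>geo_dist R' Q = angle (R' \<bullet> Q)\<close> and \<open>R' \<bullet> Q\<close> is linear in \<open>R'\<close>, the chain rule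
  gives the differential \<open>W \<mapsto> - c * (W \<bullet> Q)\<close> with \<open>c = grad_coeff g' (R \<bullet> Q)\<close>. The
  gradient represents it: with \<open>W = R ** B\<close>, only the skew part of \<open>transpose R ** Q\<close>
  contributes to \<open>W \<bullet> Q\<close>.\<close>

lemma riem_grad_interaction:
  assumes R: "R \<in> SO3" and Q: "Q \<in> SO3" and RQ: "R \<bullet> Q > -1"
    and g_deriv: "\<And>x. 0 \<le> x \<Longrightarrow> (g has_real_derivative g' x) (at x within {0..})"
    and K: "\<And>R'. R' \<in> SO3 \<Longrightarrow> K R' = g ((geo_dist R' Q)\<^sup>2)"
  shows "riem_grad K R = - (grad_coeff g' (R \<bullet> Q) *\<^sub>R (R ** (transpose R ** Q - transpose Q ** R)))"
proof (rule riem_grad_eqI[OF R])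
  define c where "c = grad_coeff g' (R \<bullet> Q)"
  define A where "A = transpose R ** Q - transpose Q ** R"
  have skewA: "transpose A = - A"
    by (simp add: A_def matrix_transpose_mul transpose_diff)
  have s: "-1 < R \<bullet> Q" "R \<bullet> Q \<le> 3" using RQ inner_SO3_bounds[OF R Q] by auto
  have gd: "geo_dist R' Q = angle (R' \<bullet> Q)" for R'
    by (simp add: geo_dist_def angle_def trace_mult_transpose)
  have "(g has_real_derivative g' ((angle (R \<bullet> Q))\<^sup>2))
      (at ((angle (R \<bullet> Q))\<^sup>2) within (\<lambda>s. (angle s)\<^sup>2) ` {-1..3})"
    by (rule has_field_derivative_subset[OF g_deriv]) auto
  from DERIV_image_chain[OF this angle_square_deriv[OF s]]
  have "((\<lambda>s. g ((angle s)\<^sup>2)) has_real_derivative - c) (at (R \<bullet> Q) within {-1..3})"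
    by (simp add: o_def c_def grad_coeff_def)
  then have "((\<lambda>s. g ((angle s)\<^sup>2)) has_derivative (\<lambda>h. - c * h))
      (at (R \<bullet> Q) within (\<lambda>R'. R' \<bullet> Q) ` SO3)"
    unfolding has_field_derivative_def
    by (rule has_derivative_subset) (use inner_SO3_bounds[OF _ Q] in auto)
  then have "((\<lambda>R'. g ((angle (R' \<bullet> Q))\<^sup>2)) has_derivative (\<lambda>W. - c * (W \<bullet> Q))) (at R within SO3)"
    by (rule has_derivative_in_compose[OF
          bounded_linear_imp_has_derivative[OF bounded_linear_inner_left]])
  then have D: "(K has_derivative (\<lambda>W. - c * (W \<bullet> Q))) (at R within SO3)"
    by (rule has_derivative_transform[OF R, rotated]) (simp add: K gd)
  have "has_riem_grad K (R ** (- c *\<^sub>R A)) R"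
    unfolding has_riem_grad_def
  proof (intro conjI exI ballI)
    show "R ** (- c *\<^sub>R A) \<in> tangent_SO3 R"
      using skewA
      by (auto simp: tangent_SO3_def transpose_scalar transpose_minus intro!: exI[of _ "- c *\<^sub>R A"])
    show "(K has_derivative (\<lambda>W. - c * (W \<bullet> Q))) (at R within SO3)" by (rule D)
    fix W assume "W \<in> tangent_SO3 R"
    then obtain B where B: "W = R ** B" "transpose B = - B" by (auto simp: tangent_SO3_def)
    have l: "transpose R ** (R ** M) = M" for M
      using SO3_D(1)[OF R] by (simp add: matrix_mul_assoc)
    have 1: "W \<bullet> Q = B \<bullet> (transpose R ** Q)"
      unfolding B(1) trace_mult_transpose[symmetric]
      by (simp add: matrix_transpose_mul matrix_mul_assoc)
    have 2: "B \<bullet> transpose M = - (B \<bullet> M)" for M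
    proof -
      have "B \<bullet> transpose M = transpose B \<bullet> M"
        by (simp add: inner_vec_def transpose_def sum_3)
      then show ?thesis by (simp add: B(2))
    qed
    have "transpose Q ** R = transpose (transpose R ** Q)" by (simp add: matrix_transpose_mul)
    then have "A \<bullet> B = 2 * (W \<bullet> Q)"
      using 2[of "transpose R ** Q"] by (simp add: A_def inner_diff_right inner_commute[of _ B] 1)
    then show "- c * (W \<bullet> Q) = metric_SO3 R (R ** (- c *\<^sub>R A)) W"
      by (simp add: metric_SO3_def B(1) l)
  qed
  also have "R ** (- c *\<^sub>R A) = - (c *\<^sub>R (R ** A))"
    by (simp add: matrix_scalar_ac scalar_matrix_assoc
        bounded_bilinear.minus_right[OF bounded_bilinear_matrix_mult])
  finally show "has_riem_grad K (- (grad_coeff g' (R \<bullet> Q) *\<^sub>R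
      (R ** (transpose R ** Q - transpose Q ** R)))) R"
    by (simp add: c_def A_def)
qed

text \<open>The negative gradient kernel on \<^const>\<open>Deps\<close> extends to a bounded Lipschitz kernel \<open>F\<close> on the
  whole matrix space. Both matrix arguments are projected onto a ball and the argument of
  the scalar coefficient is clamped to the interval on which that coefficient is
  Lipschitz. For \<open>R\<close> in the ball, \<open>F R Q\<close> is still \<open>R\<close> times a skew matrix, which is the
  second property: along a trajectory \<open>\<gamma>\<close> in the ball it makes \<open>\<gamma> ** transpose \<gamma>\<close>
  constant, even off \<^const>\<open>SO3\<close>.\<close>

lemma velocity_kernel_extension:
  assumes eps: "0 < \<epsilon>" "\<epsilon> < pi/2"
    and g_deriv: "\<And>x. 0 \<le> x \<Longrightarrow> (g has_real_derivative g' x) (at x within {0..})"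
    and g'_lip: "locally_lipschitz_on {0..} g'"
    and K_form: "\<And>R Q. R \<in> SO3 \<Longrightarrow> Q \<in> SO3 \<Longrightarrow> K R Q = g ((geo_dist R Q)\<^sup>2)"
  obtains F :: "mat3 \<Rightarrow> mat3 \<Rightarrow> mat3" and M L
  where "\<And>R Q. R \<in> Deps \<epsilon> \<Longrightarrow> Q \<in> Deps \<epsilon> \<Longrightarrow> riem_grad (\<lambda>R'. K R' Q) R = - F R Q"
    "\<And>R Q. norm R \<le> 2 \<Longrightarrow> F R Q ** transpose R + R ** transpose (F R Q) = 0"
    "0 \<le> M" "0 \<le> L" "\<And>R Q. norm (F R Q) \<le> M"
    "\<And>R Q R' Q'. norm (F R Q - F R' Q') \<le> L * (norm (R - R') + norm (Q - Q'))"
proof -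
  obtain \<delta> where \<delta>: "0 < \<delta>" "\<delta> \<le> 1" "\<And>R Q. R \<in> Deps \<epsilon> \<Longrightarrow> Q \<in> Deps \<epsilon> \<Longrightarrow> -1 + \<delta> \<le> R \<bullet> Q"
    using Deps_inner_lower_bound[OF eps] by blast
  \<comment> \<open>The radius exceeds \<open>sqrt 3\<close>, the norm of a rotation.\<close>
  define clip :: "mat3 \<Rightarrow> mat3" where "clip = closest_point (cball 0 2)"
  define clamp where "clamp s = max (-1 + \<delta>) (min 3 s)" for s :: real
  define F where "F R Q = grad_coeff g' (clamp (clip R \<bullet> clip Q)) *\<^sub>R
      (clip R ** (transpose (clip R) ** clip Q - transpose (clip Q) ** clip R))" for R Q
  have clip_self: "clip R = R" if "norm R \<le> 2" for R
    using that by (simp add: clip_def closest_point_self)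
  have clip: "1-lipschitz_on UNIV clip"
    by (auto simp: lipschitz_on_def clip_def intro!: closest_point_lipschitz)
  have clip_bl: "bounded_lipschitz_on UNIV clip"
    unfolding bounded_lipschitz_on_def
  proof
    have "range clip \<subseteq> cball 0 2"
      using closest_point_in_set[of "cball (0::mat3) 2"]
      by (auto simp: clip_def simp del: mem_cball)
    then show "bounded (range clip)" using bounded_cball bounded_subset by blast
  qed (use clip in blast)
  have fst_lip: "1-lipschitz_on UNIV (fst :: mat3 \<times> mat3 \<Rightarrow> mat3)"
    and snd_lip: "1-lipschitz_on UNIV (snd :: mat3 \<times> mat3 \<Rightarrow> mat3)"
    by (auto simp: lipschitz_on_def dist_fst_le dist_snd_le)
  have c1: "bounded_lipschitz_on UNIV (\<lambda>p :: mat3 \<times> mat3. clip (fst p))"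
    by (rule bounded_lipschitz_on_compose[OF clip_bl fst_lip]) simp
  have c2: "bounded_lipschitz_on UNIV (\<lambda>p :: mat3 \<times> mat3. clip (snd p))"
    by (rule bounded_lipschitz_on_compose[OF clip_bl snd_lip]) simp
  have "bounded_lipschitz_on UNIV (\<lambda>p :: mat3 \<times> mat3. clip (fst p) \<bullet> clip (snd p))"
    by (intro bounded_lipschitz_on_bilinear[OF bounded_bilinear_inner] c1 c2)
  then obtain C where C: "C-lipschitz_on UNIV (\<lambda>p :: mat3 \<times> mat3. clip (fst p) \<bullet> clip (snd p))"
    by (auto simp: bounded_lipschitz_on_def)
  have "1-lipschitz_on UNIV clamp"
    by (auto simp: lipschitz_on_def clamp_def dist_real_def)
  moreover have "range clamp \<subseteq> {-1 + \<delta>..3}" using \<delta> by (auto simp: clamp_def)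
  ultimately have "bounded_lipschitz_on UNIV (\<lambda>s. grad_coeff g' (clamp s))"
    by (rule bounded_lipschitz_on_compose[OF grad_coeff_bounded_lipschitz[OF g'_lip \<delta>(1)]])
  from bounded_lipschitz_on_compose[OF this C]
  have c3: "bounded_lipschitz_on UNIV (\<lambda>p. grad_coeff g' (clamp (clip (fst p) \<bullet> clip (snd p))))"
    by simp
  have "bounded_lipschitz_on UNIV (\<lambda>p. F (fst p) (snd p))"
    unfolding F_def
    by (intro bounded_lipschitz_on_bilinear[OF bounded_bilinear_scaleR]
        bounded_lipschitz_on_bilinear[OF bounded_bilinear_matrix_mult]
        bounded_lipschitz_on_diff bounded_lipschitz_on_linear[OF bounded_linear_transpose] c1 c2 c3)
  then obtain M L where bds: "0 \<le> M" "0 \<le> L" "\<And>p. norm (F (fst p) (snd p)) \<le> M"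
    "\<And>p q. norm (F (fst p) (snd p) - F (fst q) (snd q)) \<le> L * dist p q"
    by (rule bounded_lipschitz_onE) auto
  show thesis
  proof (rule that[of F M L])
    fix R Q assume RQ: "R \<in> Deps \<epsilon>" "Q \<in> Deps \<epsilon>"
    then have SO: "R \<in> SO3" "Q \<in> SO3" by (auto simp: Deps_def)
    have "sqrt 3 \<le> 2" by (simp add: real_sqrt_le_iff[of 3 4, simplified])
    then have "clip R = R" "clip Q = Q" using SO by (auto intro!: clip_self simp: norm_SO3)
    moreover have "clamp (R \<bullet> Q) = R \<bullet> Q"
      using \<delta>(3)[OF RQ] inner_SO3_bounds[OF SO] by (simp add: clamp_def)
    moreover have "R \<bullet> Q > -1" using \<delta>(1) \<delta>(3)[OF RQ] by simp
    ultimately show "riem_grad (\<lambda>R'. K R' Q) R = - F R Q"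
      using riem_grad_interaction[OF SO, of g g' "\<lambda>R'. K R' Q"] g_deriv K_form[OF _ SO(2)]
      by (simp add: F_def)
  next
    fix R Q :: mat3 assume "norm R \<le> 2"
    then have R: "clip R = R" by (rule clip_self)
    define A where "A = grad_coeff g' (clamp (R \<bullet> clip Q)) *\<^sub>R
      (transpose R ** clip Q - transpose (clip Q) ** R)"
    have "F R Q = R ** A" by (simp add: F_def A_def R matrix_scalar_ac scalar_matrix_assoc)
    moreover have "transpose A = - A"
      by (simp add: A_def transpose_scalar matrix_transpose_mul
          transpose_diff scaleR_minus_right[symmetric]
          del: scaleR_minus_right)
    ultimately show "F R Q ** transpose R + R ** transpose (F R Q) = 0"
      using bounded_bilinear.minus_left[OF bounded_bilinear_matrix_mult, of A "transpose R"]
        bounded_bilinear.minus_right[OF bounded_bilinear_matrix_mult, of R "A ** transpose R"]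
      by (simp add: matrix_transpose_mul matrix_mul_assoc[symmetric])
  next
    fix R Q R' Q' :: mat3
    show "norm (F R Q) \<le> M" using bds(3)[of "(R, Q)"] by simp
    have "norm (F R Q - F R' Q') \<le> L * dist (R, Q) (R', Q')"
      using bds(4)[of "(R, Q)" "(R', Q')"] by simp
    also have "dist (R, Q) (R', Q') \<le> norm (R - R') + norm (Q - Q')"
      by (simp add: dist_norm norm_Pair sqrt_sum_squares_le_sum)
    finally show "norm (F R Q - F R' Q') \<le> L * (norm (R - R') + norm (Q - Q'))"
      using bds(2) by (simp add: mult_left_mono)
  qed (use bds in auto)
qed

section \<open>Support, invariance of the rotation group, and stability of flows\<close>

text \<open>The complement of the support is a union of null open sets; by the Lindelof property
  countably many of them suffice.\<close>

lemma msupport_complement_null: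
  fixes \<mu> :: "'a::second_countable_topology measure"
  assumes "sets \<mu> = sets (restrict_space borel D)"
  shows "space \<mu> - msupport \<mu> \<in> null_sets \<mu>"
proof -
  have space: "space \<mu> = D" using sets_eq_imp_space_eq[OF assms] by (simp add: space_restrict_space)
  have meas: "U \<inter> space \<mu> \<in> sets \<mu>" if "open U" for U
    using that by (auto simp: assms space sets_restrict_space)
  define \<U> where "\<U> = {U. open U \<and> emeasure \<mu> (U \<inter> space \<mu>) = 0}"
  obtain \<V> where \<V>: "\<V> \<subseteq> \<U>" "countable \<V>" "\<Union>\<V> = \<Union>\<U>"
    using Lindelof[of \<U>] by (auto simp: \<U>_def)
  have "space \<mu> - msupport \<mu> = (\<Union>U\<in>\<U>. U \<inter> space \<mu>)"
    by (auto simp: msupport_def \<U>_def zero_less_iff_neq_zero)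
  also have "\<dots> = (\<Union>U\<in>\<V>. U \<inter> space \<mu>)" using \<V>(3) by blast
  also have "\<dots> \<in> null_sets \<mu>"
    using \<V>(1) meas by (intro null_sets_UN' \<V>(2)) (auto simp: \<U>_def null_sets_def)
  finally show ?thesis .
qed

lemma restrict_to_support:
  fixes \<mu> :: "'a::second_countable_topology measure"
  assumes \<mu>: "prob_space \<mu>" "sets \<mu> = sets (restrict_space borel D)"
  defines "N \<equiv> restrict_space \<mu> (msupport \<mu>)"
  shows "prob_space N" "space N = msupport \<mu>" "(\<lambda>x. x) \<in> borel_measurable N"
proof -
  interpret prob_space \<mu> by fact
  have null: "space \<mu> - msupport \<mu> \<in> null_sets \<mu>" by (rule msupport_complement_null) fact
  have sub: "msupport \<mu> \<subseteq> space \<mu>" by (auto simp: msupport_def)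
  then have eq: "msupport \<mu> = space \<mu> - (space \<mu> - msupport \<mu>)" by blast
  have meas: "msupport \<mu> \<in> events" using null by (subst eq) auto
  have "AE x in \<mu>. x \<in> msupport \<mu>"
    by (rule AE_I'[OF null]) auto
  then have "emeasure \<mu> (msupport \<mu>) = 1" using meas by (simp add: emeasure_eq_1_AE)
  then show "prob_space N" unfolding N_def by (rule prob_space_restrict_space[OF meas])
  show "space N = msupport \<mu>" using sub by (auto simp: N_def space_restrict_space)
  have "(\<lambda>x. x) \<in> borel_measurable \<mu>"
    unfolding measurable_cong_sets[OF \<mu>(2) refl] by (intro measurable_restrict_space1) simp
  then show "(\<lambda>x. x) \<in> borel_measurable N" unfolding N_def by (rule measurable_restrict_space1)
qed

text \<open>The hypothesis on \<open>V\<close> says that \<open>\<gamma> ** transpose \<gamma>\<close> has derivative zero, so orthogonality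
  propagates without a uniqueness argument for a differential equation; the determinant is
  then constant by continuity.\<close>

lemma SO3_flow_invariant:
  fixes \<gamma> :: "real \<Rightarrow> mat3"
  assumes deriv: "\<And>t. t \<in> {0..T} \<Longrightarrow> (\<gamma> has_vector_derivative V t) (at t within {0..T})"
    and tangent: "\<And>t. t \<in> {0..T} \<Longrightarrow> V t ** transpose (\<gamma> t) + \<gamma> t ** transpose (V t) = 0"
    and init: "\<gamma> 0 \<in> SO3" and t: "t \<in> {0..T}"
  shows "\<gamma> t \<in> SO3"
proof -
  have 0: "0 \<in> {0..T}" using t by auto
  have "((\<lambda>t. \<gamma> t ** transpose (\<gamma> t)) has_vector_derivative 0) (at t within {0..T})"
    if "t \<in> {0..T}" for t
    using bounded_bilinear.has_vector_derivative[OF bounded_bilinear_matrix_mult deriv[OF that]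
        bounded_linear.has_vector_derivative[OF bounded_linear_transpose deriv[OF that]]]
      tangent[OF that]
    by (simp add: add.commute)
  then obtain c where "\<And>t. t \<in> {0..T} \<Longrightarrow> \<gamma> t ** transpose (\<gamma> t) = c"
    using has_vector_derivative_zero_constant[of "{0..T}" "\<lambda>t. \<gamma> t ** transpose (\<gamma> t)"] by auto
  then have "\<gamma> t ** transpose (\<gamma> t) = mat 1" if "t \<in> {0..T}" for t
    using that 0 SO3_D(2)[OF init] by metis
  then have orth: "orthogonal_matrix (\<gamma> t)" if "t \<in> {0..T}" for t
    using that orthogonal_matrix[of "transpose (\<gamma> t)"] by simp
  have "continuous_on {0..T} \<gamma>"
    unfolding continuous_on_eq_continuous_within
    by (intro ballI has_vector_derivative_continuous[OF deriv])
  from det_constant_on_connected[OF connected_Icc this orth 0 SO3_D(3)[OF init] t] orth[OF t]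
  show ?thesis by (simp add: SO3_def rotation_matrix_def)
qed

text \<open>Two families of curves with the same initial values and bounded difference, whose
  velocities differ at most \<open>C\<close> times as much as the families do, uniformly over the
  family, coincide on a time interval shorter than \<open>1 / C\<close>. The contraction is iterated on
  a uniform bound; a Gronwall argument would need regularity in time of the supremum over
  the family.\<close>

lemma flows_agree:
  fixes \<Psi> \<Phi> :: "real \<Rightarrow> 'a \<Rightarrow> 'e::real_normed_vector"
  assumes \<Psi>: "\<And>t x. x \<in> S \<Longrightarrow> t \<in> {0..<T} \<Longrightarrow>
      ((\<lambda>s. \<Psi> s x) has_vector_derivative a t x) (at t within {0..<T})"
    and \<Phi>: "\<And>t x. x \<in> S \<Longrightarrow> t \<in> {0..<T} \<Longrightarrow>
      ((\<lambda>s. \<Phi> s x) has_vector_derivative b t x) (at t within {0..<T})"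
    and init: "\<And>x. x \<in> S \<Longrightarrow> \<Psi> 0 x = \<Phi> 0 x"
    and bound: "\<And>t x. x \<in> S \<Longrightarrow> t \<in> {0..<T} \<Longrightarrow> norm (\<Psi> t x - \<Phi> t x) \<le> W"
    and field: "\<And>W t x. (\<And>t x. x \<in> S \<Longrightarrow> t \<in> {0..<T} \<Longrightarrow> norm (\<Psi> t x - \<Phi> t x) \<le> W) \<Longrightarrow>
        x \<in> S \<Longrightarrow> t \<in> {0..<T} \<Longrightarrow> norm (a t x - b t x) \<le> C * W"
    and C: "0 \<le> C" "C * T < 1" and x: "x \<in> S" and t: "t \<in> {0..<T}"
  shows "\<Psi> t x = \<Phi> t x"
proof -
  have T: "0 \<in> {0..<T}" using t by auto
  have iter: "norm (\<Psi> t x - \<Phi> t x) \<le> (C * T) ^ n * W" if "x \<in> S" "t \<in> {0..<T}" for n t x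
    using that
  proof (induction n arbitrary: t x)
    case 0
    then show ?case using bound by simp
  next
    case (Suc n)
    have "norm ((\<Psi> t x - \<Phi> t x) - (\<Psi> 0 x - \<Phi> 0 x)) \<le> C * ((C * T) ^ n * W) * \<bar>t - 0\<bar>"
    proof (rule vector_derivative_bound[of "{0..<T}"])
      fix s assume s: "s \<in> {0..<T}"
      show "((\<lambda>t. \<Psi> t x - \<Phi> t x) has_vector_derivative a s x - b s x) (at s within {0..<T})"
        by (intro has_vector_derivative_diff \<Psi> \<Phi> Suc.prems s)
      show "norm (a s x - b s x) \<le> C * ((C * T) ^ n * W)"
        by (rule field[OF Suc.IH Suc.prems(1) s])
    qed (use Suc.prems T in auto)
    also have "\<dots> \<le> C * ((C * T) ^ n * W) * T"
    proof (rule mult_left_mono)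
      have "0 \<le> (C * T) ^ n * W" using order_trans[OF norm_ge_zero Suc.IH[OF Suc.prems]] .
      then show "0 \<le> C * ((C * T) ^ n * W)" using C by simp
    qed (use Suc.prems in auto)
    finally show ?case using init[OF Suc.prems(1)] by (simp add: mult_ac)
  qed
  have "(\<lambda>n. (C * T) ^ n * W) \<longlonglongrightarrow> 0 * W"
    using C T by (intro tendsto_mult LIMSEQ_realpow_zero tendsto_const) auto
  from LIMSEQ_le_const[OF this, of "norm (\<Psi> t x - \<Phi> t x)"] iter[OF x t]
  show ?thesis by auto
qed

lemma velocity_push_forward:
  assumes F: "\<And>R Q. R \<in> Deps \<epsilon> \<Longrightarrow> Q \<in> Deps \<epsilon> \<Longrightarrow> riem_grad (\<lambda>R'. K R' Q) R = - F R Q"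
    and cont: "\<And>R. continuous_on UNIV (F R)"
    and \<psi>: "\<psi> \<in> N \<rightarrow>\<^sub>M restrict_space borel (Deps \<epsilon>)"
    and \<rho>: "\<rho> t = distr N (restrict_space borel (Deps \<epsilon>)) \<psi>"
    and R: "R \<in> Deps \<epsilon>"
  shows "velocity K \<rho> t R = (\<integral>y. F R (\<psi> y) \<partial>N)"
proof -
  have "(\<integral>Q. riem_grad (\<lambda>R'. K R' Q) R \<partial>\<rho> t) = (\<integral>Q. - F R Q \<partial>\<rho> t)"
    by (rule Bochner_Integration.integral_cong) (auto simp: \<rho> space_restrict_space F[OF R])
  then have "velocity K \<rho> t R = (\<integral>Q. F R Q \<partial>\<rho> t)" by (simp add: velocity_def)
  also have "\<dots> = (\<integral>y. F R (\<psi> y) \<partial>N)"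
    unfolding \<rho>
    by (intro integral_distr \<psi> borel_measurable_continuous_on_restrict
        continuous_on_subset[OF cont]) auto
  finally show ?thesis .
qed

lemma mean_field_difference:
  fixes F :: "'e::euclidean_space \<Rightarrow> 'e \<Rightarrow> 'e"
  assumes "prob_space N" and cont: "\<And>a. continuous_on UNIV (F a)"
    and bound: "\<And>a b. norm (F a b) \<le> M"
    and lip: "\<And>a b a' b'. norm (F a b - F a' b') \<le> L * (norm (a - a') + norm (b - b'))"
    and L: "0 \<le> L"
    and [measurable]: "\<phi> \<in> borel_measurable N" "\<psi> \<in> borel_measurable N"
    and close: "norm (a - a') \<le> W" "\<And>y. y \<in> space N \<Longrightarrow> norm (\<phi> y - \<psi> y) \<le> W"
  shows "norm ((\<integral>y. F a (\<phi> y) \<partial>N) - (\<integral>y. F a' (\<psi> y) \<partial>N)) \<le> 2 * L * W"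
proof -
  interpret prob_space N by fact
  have [measurable]: "F a \<in> borel_measurable borel" for a
    by (rule borel_measurable_continuous_onI) (rule cont)
  have int: "integrable N (\<lambda>y. F a (\<phi> y))" "integrable N (\<lambda>y. F a (\<psi> y))" for a
    by (rule integrable_const_bound[where B = M]; simp add: bound)+
  have "norm (\<integral>y. F a (\<phi> y) - F a' (\<psi> y) \<partial>N) \<le> 2 * L * W"
  proof (rule norm_integral_le_const)
    fix y assume y: "y \<in> space N"
    have "norm (F a (\<phi> y) - F a' (\<psi> y)) \<le> L * (norm (a - a') + norm (\<phi> y - \<psi> y))" by (rule lip)
    also have "\<dots> \<le> L * (W + W)"
      using close(1) close(2)[OF y] L by (intro mult_left_mono add_mono) auto
    finally show "norm (F a (\<phi> y) - F a' (\<psi> y)) \<le> 2 * L * W" by simp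
  qed (auto simp: int)
  then show ?thesis by (simp add: int)
qed

lemma compact_trace_margin:
  assumes "compact S" "\<And>R. R \<in> S \<Longrightarrow> trace (R :: mat3) > c"
  obtains \<kappa> where "0 < \<kappa>" "\<And>R. R \<in> S \<Longrightarrow> c + \<kappa> \<le> trace R"
proof (cases "S = {}")
  case False
  have "continuous_on S (trace :: mat3 \<Rightarrow> real)"
    unfolding trace_eq_inner by (intro continuous_intros)
  from continuous_attains_inf[OF assms(1) False this] obtain P where
    P: "P \<in> S" "\<And>R. R \<in> S \<Longrightarrow> trace P \<le> trace R" by blast
  show thesis by (rule that[of "trace P - c"]) (use P assms(2) in auto)
qed (use that[of 1] in auto)

text \<open>A mean-field trajectory that starts in \<^const>\<open>SO3\<close> moves by at most \<open>M * T\<close>. For \<open>T\<close> this small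
  it remains in the ball of radius \<open>2\<close> where the field is tangent, and so in \<^const>\<open>SO3\<close>, and
  its trace stays above the threshold that defines \<^const>\<open>Deps\<close>.\<close>

lemma SO3_flow_stays_in_Deps:
  fixes F :: "mat3 \<Rightarrow> mat3 \<Rightarrow> mat3"
  assumes eps: "0 < \<epsilon>" "\<epsilon> < pi/2" and "prob_space N" and cont: "\<And>a. continuous_on UNIV (F a)"
    and bound: "\<And>a b. norm (F a b) \<le> M"
    and tangent: "\<And>R Q. norm R \<le> 2 \<Longrightarrow> F R Q ** transpose R + R ** transpose (F R Q) = 0"
    and \<psi>: "\<And>t. t \<in> {0..T} \<Longrightarrow> \<psi> t \<in> borel_measurable N"
    and \<gamma>: "\<And>t. t \<in> {0..T} \<Longrightarrow>
      (\<gamma> has_vector_derivative (\<integral>y. F (\<gamma> t) (\<psi> t y) \<partial>N)) (at t within {0..T})"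
    and init: "\<gamma> 0 \<in> SO3" "1 + 2 * sin \<epsilon> + \<kappa> \<le> trace (\<gamma> 0)"
    and T: "M * T \<le> 1/8" "2 * (M * T) < \<kappa>" and t: "t \<in> {0..T}"
  shows "\<gamma> t \<in> Deps \<epsilon>"
proof -
  interpret prob_space N by fact
  have [measurable]: "F a \<in> borel_measurable borel" for a
    by (rule borel_measurable_continuous_onI) (rule cont)
  have int: "integrable N (\<lambda>y. F a (\<psi> t y))" if "t \<in> {0..T}" for a t
    using \<psi>[OF that] by (intro integrable_const_bound[where B = M]) (auto simp: bound)
  have M0: "0 \<le> M" using order_trans[OF norm_ge_zero bound] .
  have disp: "norm (\<gamma> t - \<gamma> 0) \<le> M * T" if t: "t \<in> {0..T}" for t
  proof -
    have "norm (\<gamma> t - \<gamma> 0) \<le> M * \<bar>t - 0\<bar>"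
    proof (rule vector_derivative_bound[of "{0..T}", OF _ \<gamma>])
      fix s assume "s \<in> {0..T}"
      then show "norm (\<integral>y. F (\<gamma> s) (\<psi> s y) \<partial>N) \<le> M"
        by (intro norm_integral_le_const int) (auto simp: bound)
    qed (use t in auto)
    also have "\<dots> \<le> M * T" using t M0 by (intro mult_left_mono) auto
    finally show ?thesis .
  qed
  have sqrt3: "sqrt 3 \<le> 7/4" by (rule real_le_lsqrt) (auto simp: power2_eq_square)
  have norm_le: "norm (\<gamma> t) \<le> 2" if "t \<in> {0..T}" for t
    using norm_triangle_sub[of "\<gamma> t" "\<gamma> 0"] disp[OF that] norm_SO3[OF init(1)] sqrt3 T(1) by simp
  have SO: "\<gamma> t \<in> SO3"
  proof (rule SO3_flow_invariant[OF \<gamma> _ init(1) t])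
    fix s assume s: "s \<in> {0..T}"
    \<comment> \<open>The tangency condition is linear in the velocity and passes to the average over \<open>N\<close>.\<close>
    let ?T = "\<lambda>V. V ** transpose (\<gamma> s) + \<gamma> s ** transpose V"
    have "bounded_linear ?T"
      by (intro bounded_linear_add
          bounded_bilinear.bounded_linear_left[OF bounded_bilinear_matrix_mult]
          bounded_linear_compose[OF
            bounded_bilinear.bounded_linear_right[OF bounded_bilinear_matrix_mult]
            bounded_linear_transpose])
    from integral_bounded_linear[OF this int[OF s, of "\<gamma> s"]]
    show "?T (\<integral>y. F (\<gamma> s) (\<psi> s y) \<partial>N) = 0" by (simp add: tangent[OF norm_le[OF s]])
  qed
  have "\<bar>mat 1 \<bullet> (\<gamma> t - \<gamma> 0)\<bar> \<le> sqrt 3 * norm (\<gamma> t - \<gamma> 0)"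
    using Cauchy_Schwarz_ineq2[of "mat 1 :: mat3" "\<gamma> t - \<gamma> 0"] by (simp add: norm_SO3[OF SO3_id])
  also have "\<dots> \<le> 2 * (M * T)" using sqrt3 disp[OF t] by (intro mult_mono) auto
  finally have "trace (\<gamma> 0) - trace (\<gamma> t) \<le> 2 * (M * T)"
    by (simp add: trace_eq_inner inner_diff_right)
  then show ?thesis using SO init(2) T(2) by (simp add: Deps_eq[OF eps])
qed

section \<open>Weak solutions\<close>

lemma flow_map_init: "flow_map \<epsilon> X \<Sigma> T \<Psi> \<Longrightarrow> R \<in> \<Sigma> \<Longrightarrow> \<Psi> 0 R = R"
  and flow_map_Deps: "flow_map \<epsilon> X \<Sigma> T \<Psi> \<Longrightarrow> R \<in> \<Sigma> \<Longrightarrow> t \<in> {0..<T} \<Longrightarrow> \<Psi> t R \<in> Deps \<epsilon>"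
  and flow_map_deriv: "flow_map \<epsilon> X \<Sigma> T \<Psi> \<Longrightarrow> R \<in> \<Sigma> \<Longrightarrow> t \<in> {0..<T} \<Longrightarrow>
    ((\<lambda>s. \<Psi> s R) has_vector_derivative X t (\<Psi> t R)) (at t within {0..<T})"
  by (auto simp: flow_map_def)

lemma norm_Deps_diff_le: "R \<in> Deps \<epsilon> \<Longrightarrow> Q \<in> Deps \<epsilon> \<Longrightarrow> norm (R - Q) \<le> 2 * sqrt 3"
  using norm_triangle_ineq4[of R Q] by (simp add: Deps_def norm_SO3)

text \<open>The flow \<open>\<Psi>\<close> follows the field of the measures pushed forward by \<open>\<psi>\<close>, and \<open>\<Phi>\<close> that of the
  measures pushed forward by \<open>\<phi>\<close>. Two cases matter: \<open>\<psi> = \<Psi>\<close> and \<open>\<phi> = \<Phi>\<close> compares two weak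
  solutions, and \<open>\<psi> = \<phi>\<close> gives uniqueness of the flow map in a given field.\<close>

lemma flows_of_push_forwards_agree:
  assumes N: "prob_space N" "space N = \<Sigma>"
    and F: "\<And>R Q. R \<in> Deps \<epsilon> \<Longrightarrow> Q \<in> Deps \<epsilon> \<Longrightarrow> riem_grad (\<lambda>R'. K R' Q) R = - F R Q"
    and cont: "\<And>R. continuous_on UNIV (F R)" and bound: "\<And>R Q. norm (F R Q) \<le> M"
    and lip: "\<And>R Q R' Q'. norm (F R Q - F R' Q') \<le> L * (norm (R - R') + norm (Q - Q'))"
    and L: "0 \<le> L"
    and T: "2 * L * T < 1"
    and \<psi>: "\<And>t. t \<in> {0..<T} \<Longrightarrow> \<psi> t \<in> N \<rightarrow>\<^sub>M restrict_space borel (Deps \<epsilon>)"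
      "\<And>t. t \<in> {0..<T} \<Longrightarrow> \<rho> t = distr N (restrict_space borel (Deps \<epsilon>)) (\<psi> t)"
    and \<phi>: "\<And>t. t \<in> {0..<T} \<Longrightarrow> \<phi> t \<in> N \<rightarrow>\<^sub>M restrict_space borel (Deps \<epsilon>)"
      "\<And>t. t \<in> {0..<T} \<Longrightarrow> \<rho>' t = distr N (restrict_space borel (Deps \<epsilon>)) (\<phi> t)"
    and \<Psi>: "flow_map \<epsilon> (velocity K \<rho>) \<Sigma> T \<Psi>" and \<Phi>: "flow_map \<epsilon> (velocity K \<rho>') \<Sigma> T \<Phi>"
    and close: "\<And>t y. t \<in> {0..<T} \<Longrightarrow> y \<in> \<Sigma> \<Longrightarrow> norm (\<psi> t y - \<phi> t y) \<le> norm (\<Psi> t y - \<Phi> t y)"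
    and R: "R \<in> \<Sigma>" and t: "t \<in> {0..<T}"
  shows "\<Psi> t R = \<Phi> t R"
proof (rule flows_agree[of \<Sigma> T \<Psi> "\<lambda>t x. velocity K \<rho> t (\<Psi> t x)"
      \<Phi> "\<lambda>t x. velocity K \<rho>' t (\<Phi> t x)" "2 * sqrt 3" "2 * L"])
  fix W t x
  assume W: "\<And>t x. x \<in> \<Sigma> \<Longrightarrow> t \<in> {0..<T} \<Longrightarrow> norm (\<Psi> t x - \<Phi> t x) \<le> W"
    and x: "x \<in> \<Sigma>" and t: "t \<in> {0..<T}"
  have "velocity K \<rho> t (\<Psi> t x) = (\<integral>y. F (\<Psi> t x) (\<psi> t y) \<partial>N)"
    by (rule velocity_push_forward[OF F cont \<psi>(1)[OF t]]) (use \<psi>(2) flow_map_Deps[OF \<Psi> x] t in auto)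
  moreover have "velocity K \<rho>' t (\<Phi> t x) = (\<integral>y. F (\<Phi> t x) (\<phi> t y) \<partial>N)"
    by (rule velocity_push_forward[OF F cont \<phi>(1)[OF t]]) (use \<phi>(2) flow_map_Deps[OF \<Phi> x] t in auto)
  moreover have "norm ((\<integral>y. F (\<Psi> t x) (\<psi> t y) \<partial>N) - (\<integral>y. F (\<Phi> t x) (\<phi> t y) \<partial>N)) \<le> 2 * L * W"
  proof (rule mean_field_difference[OF N(1) cont bound lip L])
    show "\<psi> t \<in> borel_measurable N" "\<phi> t \<in> borel_measurable N"
      using \<psi>(1)[OF t] \<phi>(1)[OF t] by (auto simp: measurable_restrict_space2_iff)
    show "norm (\<Psi> t x - \<Phi> t x) \<le> W" using W[OF x t] .
    show "norm (\<psi> t y - \<phi> t y) \<le> W" if "y \<in> space N" for y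
      using order_trans[OF close[OF t] W[OF _ t]] that by (simp add: N(2))
  qed
  ultimately show "norm (velocity K \<rho> t (\<Psi> t x) - velocity K \<rho>' t (\<Phi> t x)) \<le> 2 * L * W" by simp
qed (use L T R t flow_map_init[OF \<Psi>] flow_map_init[OF \<Phi>] in
    \<open>auto intro!: norm_Deps_diff_le flow_map_Deps[OF \<Psi>] flow_map_Deps[OF \<Phi>]
      flow_map_deriv[OF \<Psi>] flow_map_deriv[OF \<Phi>]\<close>)

theorem theorem4p6:
  fixes \<epsilon> :: real
    and K :: "mat3 \<Rightarrow> mat3 \<Rightarrow> real"
    and g g' :: "real \<Rightarrow> real"
    and \<rho>0 :: "mat3 measure"
  assumes eps: "0 < \<epsilon>" "\<epsilon> < pi/2"
    and g_deriv: "\<And>x. 0 \<le> x \<Longrightarrow> (g has_real_derivative g' x) (at x within {0..})"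
    and g'_lip: "locally_lipschitz_on {0..} g'"
    and K_form: "\<And>R Q. R \<in> SO3 \<Longrightarrow> Q \<in> SO3 \<Longrightarrow> K R Q = g ((geo_dist R Q)\<^sup>2)"
    and rho0: "\<rho>0 \<in> ProbD \<epsilon>"
    and supp: "compact (msupport \<rho>0)" "msupport \<rho>0 \<subseteq> Deps \<epsilon>"
  shows "\<exists>T>0.
     (\<exists>\<rho>. \<rho> \<in> narrow_curves \<epsilon> T \<and> weak_solution \<epsilon> K \<rho>0 T \<rho>) \<and>
     (\<forall>\<rho> \<rho>'. \<rho> \<in> narrow_curves \<epsilon> T \<and> weak_solution \<epsilon> K \<rho>0 T \<rho> \<and>
              \<rho>' \<in> narrow_curves \<epsilon> T \<and> weak_solution \<epsilon> K \<rho>0 T \<rho>' \<longrightarrow>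
              (\<forall>t\<in>{0..<T}. \<rho> t = \<rho>' t))"
proof -
  define \<Sigma> where "\<Sigma> = msupport \<rho>0"
  define N where "N = restrict_space \<rho>0 \<Sigma>"
  define B where "B = restrict_space borel (Deps \<epsilon>)"
  have "prob_space \<rho>0" "sets \<rho>0 = sets B" using rho0 by (auto simp: ProbD_def B_def)
  from restrict_to_support[OF this[unfolded B_def]]
  have N: "prob_space N" "space N = \<Sigma>" and id_meas: "(\<lambda>x. x) \<in> borel_measurable N"
    by (auto simp: N_def \<Sigma>_def)
  interpret N: prob_space N by fact
  have \<Sigma>_SO3: "x \<in> SO3" if "x \<in> \<Sigma>" for x using that supp(2) by (auto simp: \<Sigma>_def Deps_def)
  obtain F M L where F: "\<And>R Q. R \<in> Deps \<epsilon> \<Longrightarrow> Q \<in> Deps \<epsilon> \<Longrightarrow> riem_grad (\<lambda>R'. K R' Q) R = - F R Q"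
    and tangent: "\<And>R Q. norm R \<le> 2 \<Longrightarrow> F R Q ** transpose R + R ** transpose (F R Q) = 0"
    and M: "0 \<le> M" and L: "0 \<le> L" and bound: "\<And>R Q. norm (F R Q) \<le> M"
    and lip: "\<And>R Q R' Q'. norm (F R Q - F R' Q') \<le> L * (norm (R - R') + norm (Q - Q'))"
    using velocity_kernel_extension[OF eps g_deriv g'_lip K_form] by blast
  have cont: "continuous_on UNIV (F R)" for R
    by (rule lipschitz_on_continuous_on[of L])
      (use lip[of R _ R] L in \<open>auto simp: lipschitz_on_def dist_norm\<close>)
  obtain \<kappa> where \<kappa>: "0 < \<kappa>" "\<And>R. R \<in> \<Sigma> \<Longrightarrow> 1 + 2 * sin \<epsilon> + \<kappa> \<le> trace R"
    using compact_trace_margin[OF supp(1), of "1 + 2 * sin \<epsilon>"] supp(2)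
    by (auto simp: \<Sigma>_def Deps_eq[OF eps])
  \<comment> \<open>The first bound makes the characteristic map a contraction; the other two keep the trajectories
    in the ball of radius \<open>2\<close> and above the trace threshold.\<close>
  define T where "T = min (1 / (4 * (L + 1))) (min (1 / (8 * (M + 1))) (\<kappa> / (4 * (M + 1))))"
  have T: "T > 0" using L M \<kappa>(1) by (simp add: T_def)
  have LT: "2 * L * T < 1"
  proof -
    have "(L + 1) * T \<le> (L + 1) * (1 / (4 * (L + 1)))"
      using L by (intro mult_left_mono) (auto simp: T_def)
    also have "\<dots> = 1/4" using L by simp
    finally show ?thesis using T by (simp add: algebra_simps)
  qed
  have MT: "M * T \<le> 1/8" "2 * (M * T) < \<kappa>"
  proof -
    have "(M + 1) * T \<le> (M + 1) * (1 / (8 * (M + 1)))"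
      using M by (intro mult_left_mono) (auto simp: T_def)
    also have "\<dots> = 1/8" using M by simp
    finally show "M * T \<le> 1/8" using T by (simp add: algebra_simps)
    have "(M + 1) * T \<le> (M + 1) * (\<kappa> / (4 * (M + 1)))"
      using M by (intro mult_left_mono) (auto simp: T_def)
    also have "\<dots> = \<kappa>/4" using M by (simp add: field_simps)
    finally show "2 * (M * T) < \<kappa>" using T \<kappa>(1) by (simp add: algebra_simps)
  qed
  obtain \<Psi> where \<Psi>_cont: "continuous_on UNIV (\<lambda>(t, x). \<Psi> t x)" and \<Psi>0: "\<And>x. \<Psi> 0 x = x"
    and \<Psi>_deriv: "\<And>t x. t \<in> {0..T} \<Longrightarrow>
      ((\<lambda>s. \<Psi> s x) has_vector_derivative (\<integral>y. F (\<Psi> t x) (\<Psi> t y) \<partial>N)) (at t within {0..T})"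
    by (rule mean_field_flow_exists[OF N(1) id_meas bound lip less_imp_le[OF T] L LT]) (rule that)
  have \<Psi>_cont': "continuous_on S (\<lambda>z. \<Psi> (f z) (h z))" if "continuous_on S f" "continuous_on S h"
    for S :: "'z::topological_space set" and f h
    using continuous_on_compose2[OF \<Psi>_cont, of S "\<lambda>z. (f z, h z)"] that
    by (auto intro!: continuous_intros)
  have \<Psi>_meas: "\<Psi> t \<in> borel_measurable N" for t
    by (rule measurable_compose[OF id_meas borel_measurable_continuous_onI])
      (auto intro!: \<Psi>_cont' continuous_intros)
  have \<Psi>_Deps: "\<Psi> t x \<in> Deps \<epsilon>" if "t \<in> {0..T}" "x \<in> \<Sigma>" for t x
    by (rule SO3_flow_stays_in_Deps[OF eps N(1) cont bound tangent \<Psi>_meas \<Psi>_deriv _ _ MT that(1)])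
      (use that(2) \<kappa>(2) \<Sigma>_SO3 in \<open>auto simp: \<Psi>0\<close>)
  have \<Psi>_meas': "\<Psi> t \<in> N \<rightarrow>\<^sub>M B" if "t \<in> {0..<T}" for t
    unfolding B_def using that \<Psi>_Deps by (intro measurable_restrict_space2 \<Psi>_meas) (auto simp: N(2))
  define \<rho> where "\<rho> t = distr N B (\<Psi> t)" for t
  have \<rho>_prob: "\<rho> t \<in> ProbD \<epsilon>" if "t \<in> {0..<T}" for t
    unfolding ProbD_def \<rho>_def using N.prob_space_distr[OF \<Psi>_meas'[OF that]] by (auto simp: B_def)
  have narrow: "\<rho> \<in> narrow_curves \<epsilon> T"
    unfolding narrow_curves_def narrow_conv_def
  proof (intro CollectI ballI conjI allI impI \<rho>_prob)
    fix t and f :: "mat3 \<Rightarrow> real"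
    assume t: "t \<in> {0..<T}" and f: "continuous_on (Deps \<epsilon>) f \<and> bounded (f ` Deps \<epsilon>)"
    obtain C where C: "\<And>Q. Q \<in> Deps \<epsilon> \<Longrightarrow> norm (f Q) \<le> C" using f by (auto simp: bounded_iff)
    have f_meas: "f \<in> borel_measurable B"
      unfolding B_def using f by (intro borel_measurable_continuous_on_restrict) simp
    have eq: "(\<integral>Q. f Q \<partial>\<rho> s) = (\<integral>y. f (\<Psi> s y) \<partial>N)" if "s \<in> {0..<T}" for s
      unfolding \<rho>_def by (rule integral_distr[OF \<Psi>_meas'[OF that] f_meas])
    have "continuous_on {0..<T} (\<lambda>s. \<integral>y. f (\<Psi> s y) \<partial>N)"
    proof (rule continuous_on_integral_dominated[where M = C])
      show "(\<lambda>y. f (\<Psi> s y)) \<in> borel_measurable N" if "s \<in> {0..<T}" for s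
        by (rule measurable_compose[OF \<Psi>_meas'[OF that] f_meas])
      show "continuous_on {0..<T} (\<lambda>s. f (\<Psi> s y))" if "y \<in> space N" for y
        by (rule continuous_on_compose2[OF conjunct1[OF f]])
          (use that \<Psi>_Deps in \<open>auto simp: N(2) intro!: \<Psi>_cont' continuous_intros\<close>)
      show "norm (f (\<Psi> s y)) \<le> C" if "s \<in> {0..<T}" "y \<in> space N" for s y
        using that by (intro C \<Psi>_Deps) (auto simp: N(2))
    qed (rule N.finite_measure_axioms)
    then have "continuous_on {0..<T} (\<lambda>s. \<integral>Q. f Q \<partial>\<rho> s)"
      by (rule continuous_on_eq) (simp add: eq)
    then show "((\<lambda>s. \<integral>Q. f Q \<partial>\<rho> s) \<longlongrightarrow> (\<integral>Q. f Q \<partial>\<rho> t)) (at t within {0..<T})"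
      using t by (simp add: continuous_on_def)
  qed
  have flow: "flow_map \<epsilon> (velocity K \<rho>) \<Sigma> T \<Psi>"
    unfolding flow_map_def
  proof (intro ballI conjI \<Psi>0)
    fix x t assume x: "x \<in> \<Sigma>" and t: "t \<in> {0..<T}"
    show D: "\<Psi> t x \<in> Deps \<epsilon>" using x t by (intro \<Psi>_Deps) auto
    have "velocity K \<rho> t (\<Psi> t x) = (\<integral>y. F (\<Psi> t x) (\<Psi> t y) \<partial>N)"
      by (rule velocity_push_forward[OF F cont \<Psi>_meas'[OF t, unfolded B_def] _ D])
        (auto simp: \<rho>_def B_def)
    then show "((\<lambda>s. \<Psi> s x) has_vector_derivative velocity K \<rho> t (\<Psi> t x)) (at t within {0..<T})"
      using has_vector_derivative_within_subset[OF \<Psi>_deriv[of t x], of "{0..<T}"] t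
      by (simp add: atLeastLessThan_subseteq_atLeastAtMost_iff)
  qed
  have agree: "\<Psi> t x = \<Phi> t x"
    if "flow_map \<epsilon> (velocity K \<rho>) \<Sigma> T \<Phi>" "x \<in> \<Sigma>" "t \<in> {0..<T}" for \<Phi> t x
    by (rule flows_of_push_forwards_agree[OF N F cont bound lip L LT
          _ _ _ _ flow that(1) _ that(2,3),
          where \<psi> = \<Psi> and \<phi> = \<Psi>])
      (use \<Psi>_meas' in \<open>auto simp: B_def \<rho>_def\<close>)
  have weak: "weak_solution \<epsilon> K \<rho>0 T \<rho>"
    unfolding weak_solution_def \<Sigma>_def[symmetric] N_def[symmetric] B_def[symmetric]
    using \<rho>_prob flow agree \<Psi>_meas' \<rho>_def by (intro conjI exI[of _ \<Psi>]) auto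
  have unique: "\<rho>1 t = \<rho>2 t"
    if \<rho>1: "weak_solution \<epsilon> K \<rho>0 T \<rho>1" and \<rho>2: "weak_solution \<epsilon> K \<rho>0 T \<rho>2" and t: "t \<in> {0..<T}"
    for \<rho>1 \<rho>2 t
  proof -
    obtain \<Psi>1 where 1: "flow_map \<epsilon> (velocity K \<rho>1) \<Sigma> T \<Psi>1"
      "\<And>t. t \<in> {0..<T} \<Longrightarrow> \<Psi>1 t \<in> N \<rightarrow>\<^sub>M B" "\<And>t. t \<in> {0..<T} \<Longrightarrow> \<rho>1 t = distr N B (\<Psi>1 t)"
      using \<rho>1 unfolding weak_solution_def \<Sigma>_def[symmetric] N_def[symmetric] B_def[symmetric]
      by blast
    obtain \<Psi>2 where 2: "flow_map \<epsilon> (velocity K \<rho>2) \<Sigma> T \<Psi>2"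
      "\<And>t. t \<in> {0..<T} \<Longrightarrow> \<Psi>2 t \<in> N \<rightarrow>\<^sub>M B" "\<And>t. t \<in> {0..<T} \<Longrightarrow> \<rho>2 t = distr N B (\<Psi>2 t)"
      using \<rho>2 unfolding weak_solution_def \<Sigma>_def[symmetric] N_def[symmetric] B_def[symmetric]
      by blast
    have "\<Psi>1 t x = \<Psi>2 t x" if "x \<in> \<Sigma>" for x
      by (rule flows_of_push_forwards_agree[OF N F cont bound lip L LT 1(2,3)[unfolded B_def]
            2(2,3)[unfolded B_def] 1(1) 2(1) _ that t]) auto
    then show ?thesis unfolding 1(3)[OF t] 2(3)[OF t] by (intro distr_cong) (auto simp: N(2))
  qed
  show ?thesis using T narrow weak unique by blast
qed

end
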